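(* Let $\mathbb{F}$ be a function field of one variable over a finite field with $q$ elements. Let $\mathcal{R}_{\mathbb{F}}^{-}$ be the class of those functions in $\mathcal{R}_{\mathbb{F}}$ which fail to satisfy the "Riemann hypothesis". Then $\mathcal{R}_{\mathbb{F}}^{-}$ is an open dense subfamily of $\mathcal{R}_{\mathbb{F}}$, where $\mathcal{R}_{\mathbb{F}}$ carries the topology induced from the space $\mathcal{M}$ of meromorphic functions on $\mathbb{C}$.
   Context: Zeta-function. $\mathbb{K}$ is a finite field with $q$ elements; $\mathbb{F}$ is a function field of one variable over $\mathbb{K}$ (equivalently the function field of a smooth, irreducible, projective algebraic curve over $\mathbb{K}$), with $\mathbb{K}$ as its full constant field, and $g$ denotes its genus. For $\Re s>1$, $\zeta_{\mathbb{F}}(s)=\sum_{\alpha}|\alpha|^{-s}$, where $\alpha$ ranges over the positive (effective) divisors and $|\alpha|=q^{\deg\alpha}$. With $u=q^{-s}$ one has $\zeta_{\mathbb{F}}(s)=\dfrac{L(u)}{(1-qu)(1-u)}$, where $L$ is a polynomial of degree $2g$ with real coefficients, $L(0)=1$, satisfying $L(1/(qu))=q^{-g}u^{-2g}L(u)$; this defines $\zeta_{\mathbb{F}}$ as a meromorphic function on $\mathbb{C}$. Space $\mathcal{M}$. $\mathcal{M}$ is the space of meromorphic functions on $\mathbb{C}$ with the topology of uniform convergence on compacta: a sequence $g_n$ converges to $g$ if, on each compact set $K$, the functions $g_n$ eventually have the same poles with the same principal parts as $g$ and $g_n-g$ tends to zero uniformly on $K$. This is a complete metric space. Class $\mathcal{M}_{\mathbb{F}}$.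 The set of $f\in\mathcal{M}$ such that: (i) $f(s)=\dfrac{h(u)}{(1-u)(1-qu)}$ with $u=q^{-s}$, where $h$ is holomorphic on $\mathbb{C}^*=\mathbb{C}\setminus\{0\}$ and $h(1)=L(1)$, $h(1/q)=L(1/q)$; (ii) the function $\mathcal{L}(u,h)=u^{-g}h(u)$ satisfies $\mathcal{L}(u,h)=\mathcal{L}\left(\frac{1}{qu},h\right)$; (iii) $f(s)=\overline{f(\overline{s})}$. Class $\mathcal{R}_{\mathbb{F}}$. The set of $f\in\mathcal{M}_{\mathbb{F}}$ which are rational as functions of $u$, i.e. $f(s)=\dfrac{R(u)}{(1-u)(1-qu)}$, $u=q^{-s}$, with $R$ rational, having no poles on $\mathbb{C}\setminus\{0\}$, $R(1)=L(1)$, $R(1/q)=L(1/q)$. Riemann hypothesis. The critical axis is $\Re s=1/2$. A function $f$ meromorphic on $\mathbb{C}$ satisfies the "Riemann hypothesis" if it has no non-trivial zeros off the critical axis, and fails to satisfy it if it does have non-trivial zeros off the critical axis. For functions in $\mathcal{M}_{\mathbb{F}}$ there are no trivial zeros, so this refers to all zeros $s$ with $\Re s\neq 1/2$. *)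

theory Defs
  imports "HOL-Algebra.Finite_Extensions" "HOL-Algebra.Generated_Fields" "HOL-Complex_Analysis.Complex_Analysis"
begin

section \<open>Function fields of one variable\<close>

definition function_field :: "'a set \<Rightarrow> ('a, 'b) ring_scheme \<Rightarrow> bool" where
  "function_field K F \<longleftrightarrow> field F \<and> subfield K F \<and>
     (\<exists>x\<in>carrier F. ring.transcendental F K x \<and>
        ring.finite_dimension F (generate_field F (insert x K)) (carrier F))"

definition full_constant_field :: "'a set \<Rightarrow> ('a, 'b) ring_scheme \<Rightarrow> bool" where
  "full_constant_field K F \<longleftrightarrow> (\<forall>x\<in>carrier F. \<not> ring.transcendental F K x \<longrightarrow> x \<in> K)"

text \<open>A place is represented by its valuation ring, which determines it.\<close>

definition places :: "'a set \<Rightarrow> ('a, 'b) ring_scheme \<Rightarrow> 'a set set" where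
  "places K F = {V. subring V F \<and> K \<subset> V \<and> V \<subset> carrier F \<and>
     (\<forall>x\<in>carrier F - {\<zero>\<^bsub>F\<^esub>}. x \<in> V \<or> inv\<^bsub>F\<^esub> x \<in> V)}"

definition place_ring :: "('a, 'b) ring_scheme \<Rightarrow> 'a set \<Rightarrow> ('a, 'b) ring_scheme" where
  "place_ring F V = F\<lparr>carrier := V\<rparr>"

definition place_ideal :: "('a, 'b) ring_scheme \<Rightarrow> 'a set \<Rightarrow> 'a set" where
  "place_ideal F V = V - Units (place_ring F V)"

definition residue_field :: "('a, 'b) ring_scheme \<Rightarrow> 'a set \<Rightarrow> 'a set ring" where
  "residue_field F V = place_ring F V Quot place_ideal F V"

definition place_degree :: "'a set \<Rightarrow> ('a, 'b) ring_scheme \<Rightarrow> 'a set \<Rightarrow> nat" where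
  "place_degree K F V =
     ring.dim (residue_field F V)
       ((\<lambda>k. place_ideal F V +>\<^bsub>place_ring F V\<^esub> k) ` K)
       (carrier (residue_field F V))"

text \<open>The normalized discrete valuation, for nonzero elements: writing the maximal ideal
  as \<open>t V\<close>, the element \<open>x\<close> is \<open>t\<^sup>n\<close> times a unit of \<open>V\<close>.\<close>

definition place_val :: "('a, 'b) ring_scheme \<Rightarrow> 'a set \<Rightarrow> 'a \<Rightarrow> int" where
  "place_val F V x = (THE n. \<exists>t\<in>V. \<exists>w\<in>Units (place_ring F V).
     place_ideal F V = {t \<otimes>\<^bsub>F\<^esub> y | y. y \<in> V} \<and> x = (t [^]\<^bsub>F\<^esub> n) \<otimes>\<^bsub>F\<^esub> w)"

definition divisors :: "'a set \<Rightarrow> ('a, 'b) ring_scheme \<Rightarrow> ('a set \<Rightarrow> int) set" where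
  "divisors K F = {A. finite {V. A V \<noteq> 0} \<and> {V. A V \<noteq> 0} \<subseteq> places K F}"

definition effective_divisors :: "'a set \<Rightarrow> ('a, 'b) ring_scheme \<Rightarrow> ('a set \<Rightarrow> int) set" where
  "effective_divisors K F = {A \<in> divisors K F. \<forall>V. A V \<ge> 0}"

definition divisor_degree :: "'a set \<Rightarrow> ('a, 'b) ring_scheme \<Rightarrow> ('a set \<Rightarrow> int) \<Rightarrow> int" where
  "divisor_degree K F A = (\<Sum>V | A V \<noteq> 0. A V * int (place_degree K F V))"

definition riemann_roch_space ::
    "'a set \<Rightarrow> ('a, 'b) ring_scheme \<Rightarrow> ('a set \<Rightarrow> int) \<Rightarrow> 'a set" where
  "riemann_roch_space K F A =
     {x \<in> carrier F. x = \<zero>\<^bsub>F\<^esub> \<or> (\<forall>V\<in>places K F. place_val F V x \<ge> - A V)}"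

definition genus :: "'a set \<Rightarrow> ('a, 'b) ring_scheme \<Rightarrow> nat" where
  "genus K F = nat (SUP A\<in>divisors K F.
     divisor_degree K F A - int (ring.dim F K (riemann_roch_space K F A)) + 1)"


section \<open>The zeta function\<close>

definition divisor_norm :: "'a set \<Rightarrow> ('a, 'b) ring_scheme \<Rightarrow> ('a set \<Rightarrow> int) \<Rightarrow> real" where
  "divisor_norm K F A = real (card K) powi divisor_degree K F A"

definition zeta_series :: "'a set \<Rightarrow> ('a, 'b) ring_scheme \<Rightarrow> complex \<Rightarrow> complex" where
  "zeta_series K F s = (\<Sum>\<^sub>\<infinity>A\<in>effective_divisors K F. of_real (divisor_norm K F A) powr (- s))"

definition is_L_polynomial :: "'a set \<Rightarrow> ('a, 'b) ring_scheme \<Rightarrow> real poly \<Rightarrow> bool" where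
  "is_L_polynomial K F L \<longleftrightarrow> (\<forall>s. Re s > 1 \<longrightarrow>
     (\<lambda>A. of_real (divisor_norm K F A) powr (- s)) summable_on effective_divisors K F \<and>
     (let q = of_nat (card K); u = q powr (- s)
      in zeta_series K F s = poly (map_poly of_real L) u / ((1 - q * u) * (1 - u))))"

text \<open>For a function field over a finite full constant field, the numerator of the zeta
  function exists (F. K. Schmidt) and is unique, since the identity fixes its values at
  infinitely many points; the \<open>else\<close> branch only makes the function total on
  arguments that are not such fields.\<close>

definition L_polynomial :: "'a set \<Rightarrow> ('a, 'b) ring_scheme \<Rightarrow> real poly" where
  "L_polynomial K F =
     (if \<exists>L. is_L_polynomial K F L then THE L. is_L_polynomial K F L else 1)"


section \<open>The space of meromorphic functions\<close>

text \<open>\<^const>\<open>nicely_meromorphic_on\<close> selects the canonical representative of a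
  meromorphic function: removable singularities are removed, and the value at a pole is \<open>0\<close>.\<close>

definition mero_space :: "(complex \<Rightarrow> complex) set" where
  "mero_space = {f. f nicely_meromorphic_on UNIV}"

text \<open>Once the principal parts agree on \<open>C\<close>, all singularities of \<open>g n - f\<close> on \<open>C\<close> are
  removable.\<close>

definition mero_converges :: "(nat \<Rightarrow> complex \<Rightarrow> complex) \<Rightarrow> (complex \<Rightarrow> complex) \<Rightarrow> bool" where
  "mero_converges g f \<longleftrightarrow> (\<forall>C. compact C \<longrightarrow>
     (\<forall>\<^sub>F n in sequentially. \<forall>z\<in>C. (is_pole (g n) z \<longleftrightarrow> is_pole f z) \<and>
        fls_prpart (laurent_expansion (g n) z) = fls_prpart (laurent_expansion f z)) \<and>
     uniform_limit C (\<lambda>n. remove_sings (\<lambda>z. g n z - f z)) (\<lambda>_. 0) sequentially)"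

text \<open>The topology of this convergence is metrizable, so its open sets are exactly the
  sequentially open ones.\<close>

definition mero_open :: "(complex \<Rightarrow> complex) set \<Rightarrow> bool" where
  "mero_open U \<longleftrightarrow> U \<subseteq> mero_space \<and>
     (\<forall>g f. range g \<subseteq> mero_space \<and> f \<in> U \<and> mero_converges g f \<longrightarrow>
        (\<forall>\<^sub>F n in sequentially. g n \<in> U))"

definition mero_topology :: "(complex \<Rightarrow> complex) topology" where
  "mero_topology = topology mero_open"

lemma openin_mero_topology: "openin mero_topology = mero_open"
proof -
  have "mero_open (S \<inter> T)" if "mero_open S" "mero_open T" for S T
    using that unfolding mero_open_def Int_iff eventually_conj_iff by blast
  moreover have "mero_open (\<Union>\<U>)" if "\<And>S. S \<in> \<U> \<Longrightarrow> mero_open S" for \<U>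
    unfolding mero_open_def
  proof (intro conjI allI impI)
    show "\<Union>\<U> \<subseteq> mero_space"
      using that unfolding mero_open_def by blast
  next
    fix g f assume *: "range g \<subseteq> mero_space \<and> f \<in> \<Union>\<U> \<and> mero_converges g f"
    then obtain S where "S \<in> \<U>" "f \<in> S" by blast
    with * that[of S] have "\<forall>\<^sub>F n in sequentially. g n \<in> S"
      unfolding mero_open_def by blast
    then show "\<forall>\<^sub>F n in sequentially. g n \<in> \<Union>\<U>"
      by eventually_elim (use \<open>S \<in> \<U>\<close> in blast)
  qed
  ultimately have "istopology mero_open"
    unfolding istopology_def by blast
  then show ?thesis
    by (simp add: mero_topology_def topology_inverse')
qed

lemma topspace_mero_topology: "topspace mero_topology = mero_space"
proof -
  have "mero_open mero_space"
    unfolding mero_open_def by (auto intro!: always_eventually)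
  then show ?thesis
    unfolding topspace_def openin_mero_topology by (auto simp: mero_open_def)
qed


section \<open>The classes of functions\<close>

text \<open>Identity of meromorphic functions of \<open>s\<close>, stated away from the zeros of the
  denominator.\<close>

definition has_numerator :: "nat \<Rightarrow> (complex \<Rightarrow> complex) \<Rightarrow> (complex \<Rightarrow> complex) \<Rightarrow> bool" where
  "has_numerator q f h \<longleftrightarrow> (\<forall>s. let u = of_nat q powr (- s) in
     u \<noteq> 1 \<and> of_nat q * u \<noteq> 1 \<longrightarrow> f s = h u / ((1 - u) * (1 - of_nat q * u)))"

definition interpolates_L ::
    "'a set \<Rightarrow> ('a, 'b) ring_scheme \<Rightarrow> (complex \<Rightarrow> complex) \<Rightarrow> bool" where
  "interpolates_L K F h \<longleftrightarrow>
     (let L = poly (map_poly complex_of_real (L_polynomial K F)); q = of_nat (card K)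
      in h 1 = L 1 \<and> h (1 / q) = L (1 / q))"

definition M_class :: "'a set \<Rightarrow> ('a, 'b) ring_scheme \<Rightarrow> (complex \<Rightarrow> complex) set" where
  "M_class K F = {f \<in> mero_space.
     (\<exists>h. h holomorphic_on (- {0}) \<and> has_numerator (card K) f h \<and> interpolates_L K F h \<and>
        (let q = of_nat (card K); \<L> = (\<lambda>u. u powi (- int (genus K F)) * h u)
         in \<forall>u. u \<noteq> 0 \<longrightarrow> \<L> u = \<L> (1 / (q * u)))) \<and>
     (\<forall>s. f s = cnj (f (cnj s)))}"

definition rational_without_poles_on :: "(complex \<Rightarrow> complex) \<Rightarrow> complex set \<Rightarrow> bool" where
  "rational_without_poles_on R S \<longleftrightarrow>
     (\<exists>p d. \<forall>u\<in>S. poly d u \<noteq> 0 \<and> R u = poly p u / poly d u)"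

definition R_class :: "'a set \<Rightarrow> ('a, 'b) ring_scheme \<Rightarrow> (complex \<Rightarrow> complex) set" where
  "R_class K F = {f \<in> M_class K F.
     \<exists>R. rational_without_poles_on R (- {0}) \<and> has_numerator (card K) f R \<and>
         interpolates_L K F R}"

text \<open>The conjunct on poles is essential: \<open>f s = 0\<close> also holds at the poles
  of \<open>f \<in> mero_space\<close>. Functions in \<open>M_class\<close> have no trivial zeros.\<close>

definition zero_at :: "(complex \<Rightarrow> complex) \<Rightarrow> complex \<Rightarrow> bool" where
  "zero_at f s \<longleftrightarrow> f s = 0 \<and> \<not> is_pole f s"

definition riemann_hypothesis :: "(complex \<Rightarrow> complex) \<Rightarrow> bool" where
  "riemann_hypothesis f \<longleftrightarrow> (\<forall>s. zero_at f s \<longrightarrow> Re s = 1 / 2)"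

definition R_class_minus :: "'a set \<Rightarrow> ('a, 'b) ring_scheme \<Rightarrow> (complex \<Rightarrow> complex) set" where
  "R_class_minus K F = {f \<in> R_class K F. \<not> riemann_hypothesis f}"

end

theory Submission
  imports Defs
begin

text \<open>
  Openness is Hurwitz's theorem: a zero off the critical axis persists under small perturbations,
  provided the function is not identically zero. No function of the class vanishes identically,
  because the prescribed values \<open>L(1)\<close> and \<open>L(1/q)\<close> are not both zero: otherwise the zeta function
  would be a polynomial in \<open>u\<close> and there would be only finitely many effective divisors, whereas
  the multiples of one place (which exists by Chevalley's extension argument) are infinitely many.

  For density put \<open>w = (1 - u)(1 - q u)/u\<close>, which is invariant under \<open>u \<mapsto> 1/(q u)\<close>, and
  subtract \<open>c\<^sub>n u\<^sup>g w\<^sup>k\<close> from the numerator of \<open>f\<close>, with \<open>c\<^sub>n\<close> chosen so that the new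
  function vanishes at \<open>s = -n\<close>. At \<open>u = q\<^sup>n\<close> the factor \<open>w\<^sup>k\<close> outgrows the rational numerator
  once \<open>k\<close> is large, so \<open>c\<^sub>n \<rightarrow> 0\<close>.
\<close>

section \<open>Existence of places\<close>

context ring
begin

text \<open>These are the values at \<open>y\<close> of polynomials of degree at most
  \<open>n\<close> with coefficients in \<open>I\<close>. The Horner form lets inductions peel off
  the constant term.\<close>

primrec poly_values :: "'a set \<Rightarrow> 'a \<Rightarrow> nat \<Rightarrow> 'a set" where
  "poly_values I y 0 = I"
| "poly_values I y (Suc n) = {a \<oplus> y \<otimes> b | a b. a \<in> I \<and> b \<in> poly_values I y n}"

end

text \<open>\<open>I\<close> is an ideal of the subring \<open>V\<close>, while the points
  \<open>y\<close> range over all of \<open>R\<close>. The case used later is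
  \<open>I = xV\<close>.\<close>

locale submodule_of_subring = cring R for R (structure) +
  fixes V I
  assumes V: "subring V R"
    and I_subset: "I \<subseteq> V"
    and I_zero: "\<zero> \<in> I"
    and I_add: "\<lbrakk>a \<in> I; b \<in> I\<rbrakk> \<Longrightarrow> a \<oplus> b \<in> I"
    and I_smult: "\<lbrakk>v \<in> V; a \<in> I\<rbrakk> \<Longrightarrow> v \<otimes> a \<in> I"
begin

lemma V_carrier: "v \<in> V \<Longrightarrow> v \<in> carrier R"
  using subringE(1)[OF V] by blast

lemma I_closed: "a \<in> I \<Longrightarrow> a \<in> carrier R"
  using I_subset V_carrier by blast

lemma poly_values_closed:
  assumes "y \<in> carrier R" "p \<in> poly_values I y n"
  shows "p \<in> carrier R"
  using assms(2) by (induction n arbitrary: p) (auto simp: assms(1) I_closed)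

lemma poly_values_zero:
  assumes "y \<in> carrier R"
  shows "\<zero> \<in> poly_values I y n"
proof (induction n)
  case (Suc n)
  have "\<zero> = \<zero> \<oplus> y \<otimes> \<zero>" using assms by simp
  then show ?case using Suc I_zero by auto
qed (simp add: I_zero)

lemma poly_values_add:
  assumes y: "y \<in> carrier R" and "p \<in> poly_values I y n" "r \<in> poly_values I y n"
  shows "p \<oplus> r \<in> poly_values I y n"
  using assms(2,3)
proof (induction n arbitrary: p r)
  case (Suc n)
  then obtain a b c d where *: "p = a \<oplus> y \<otimes> b" "a \<in> I" "b \<in> poly_values I y n"
    "r = c \<oplus> y \<otimes> d" "c \<in> I" "d \<in> poly_values I y n" by auto
  have cl: "a \<in> carrier R" "b \<in> carrier R" "c \<in> carrier R" "d \<in> carrier R"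
    using * poly_values_closed[OF y] I_closed by auto
  have "p \<oplus> r = (a \<oplus> c) \<oplus> y \<otimes> (b \<oplus> d)"
    unfolding *(1,4) using cl y by algebra
  moreover have "a \<oplus> c \<in> I" "b \<oplus> d \<in> poly_values I y n"
    using * Suc.IH I_add by auto
  ultimately show ?case by auto
qed (simp add: I_add)

lemma poly_values_smult:
  assumes y: "y \<in> carrier R" and v: "v \<in> V" and "p \<in> poly_values I y n"
  shows "v \<otimes> p \<in> poly_values I y n"
  using assms(3)
proof (induction n arbitrary: p)
  case (Suc n)
  then obtain a b where *: "p = a \<oplus> y \<otimes> b" "a \<in> I" "b \<in> poly_values I y n" by auto
  have cl: "a \<in> carrier R" "b \<in> carrier R" "v \<in> carrier R"
    using * poly_values_closed[OF y] I_closed V_carrier v by auto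
  have "v \<otimes> p = v \<otimes> a \<oplus> y \<otimes> (v \<otimes> b)"
    unfolding *(1) using cl y by algebra
  moreover have "v \<otimes> a \<in> I" "v \<otimes> b \<in> poly_values I y n"
    using * Suc.IH I_smult v by auto
  ultimately show ?case by auto
qed (simp add: I_smult v)

lemma poly_values_times:
  assumes y: "y \<in> carrier R" and p: "p \<in> poly_values I y n"
  shows "y \<otimes> p \<in> poly_values I y (Suc n)"
proof -
  have "y \<otimes> p = \<zero> \<oplus> y \<otimes> p" using y poly_values_closed[OF y p] by simp
  then show ?thesis using I_zero p by auto
qed

lemma poly_values_times_power:
  assumes y: "y \<in> carrier R" and p: "p \<in> poly_values I y n"
  shows "y [^] (k::nat) \<otimes> p \<in> poly_values I y (k + n)"
proof (induction k)
  case 0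
  then show ?case using p poly_values_closed[OF y p] by simp
next
  case (Suc k)
  have "y [^] Suc k \<otimes> p = y \<otimes> (y [^] k \<otimes> p)"
    using y poly_values_closed[OF y p] by (simp add: m_ac)
  then show ?case using poly_values_times[OF y Suc] by (simp del: poly_values.simps)
qed

lemma poly_values_mono:
  assumes y: "y \<in> carrier R"
  shows "poly_values I y n \<subseteq> poly_values I y (Suc n)"
proof (induction n)
  case 0
  show ?case
  proof
    fix a assume "a \<in> poly_values I y 0"
    then have "a \<in> I" "a = a \<oplus> y \<otimes> \<zero>" using y I_closed by auto
    then show "a \<in> poly_values I y (Suc 0)" using I_zero by auto
  qed
qed auto

text \<open>Horner form exposes the constant coefficient; lowering a degree needs the leading
  one.\<close>

lemma poly_values_split_top:
  assumes y: "y \<in> carrier R" and p: "p \<in> poly_values I y (Suc n)"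
  obtains r a where "r \<in> poly_values I y n" "a \<in> I" "p = r \<oplus> a \<otimes> y [^] Suc n"
  using p
proof (induction n arbitrary: p thesis)
  case 0
  then obtain a b where *: "p = a \<oplus> y \<otimes> b" "a \<in> I" "b \<in> I" by auto
  then have "p = a \<oplus> b \<otimes> y [^] Suc 0" using y I_closed by (simp add: m_comm)
  then show ?case using 0 * by auto
next
  case (Suc n)
  then obtain a b where *: "p = a \<oplus> y \<otimes> b" "a \<in> I" "b \<in> poly_values I y (Suc n)"
    by (auto simp del: poly_values.simps(2) simp: poly_values.simps(2)[of I y "Suc n"])
  obtain r c where rc: "r \<in> poly_values I y n" "c \<in> I" "b = r \<oplus> c \<otimes> y [^] Suc n"
    using Suc.IH[OF _ *(3)] by blast
  have cl: "a \<in> carrier R" "r \<in> carrier R" "c \<in> carrier R" "y [^] Suc n \<in> carrier R"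
    using * rc y poly_values_closed[OF y] I_closed by auto
  have "p = (a \<oplus> y \<otimes> r) \<oplus> c \<otimes> (y [^] Suc n \<otimes> y)"
    unfolding *(1) rc(3) using cl y by algebra
  then have "p = (a \<oplus> y \<otimes> r) \<oplus> c \<otimes> y [^] Suc (Suc n)" by simp
  moreover have "a \<oplus> y \<otimes> r \<in> poly_values I y (Suc n)" using * rc by auto
  ultimately show ?case using Suc.prems(1) rc by blast
qed

text \<open>With \<open>z\<close> inverse to \<open>y\<close>, the factor \<open>y [^] k\<close>
  turns a polynomial in \<open>z\<close> into the one in \<open>y\<close> with reversed
  coefficients.\<close>

lemma poly_values_reverse:
  assumes y: "y \<in> carrier R" "z \<in> carrier R" "y \<otimes> z = \<one>" and b: "b \<in> poly_values I z k"
  shows "y [^] k \<otimes> b \<in> poly_values I y k"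
  using b
proof (induction k arbitrary: b)
  case 0
  then show ?case using I_closed by simp
next
  case (Suc k)
  then obtain a c where *: "b = a \<oplus> z \<otimes> c" "a \<in> I" "c \<in> poly_values I z k" by auto
  have cl: "a \<in> carrier R" "c \<in> carrier R" "y [^] k \<in> carrier R"
    using * y poly_values_closed[OF y(2)] I_closed by auto
  have "y [^] Suc k \<otimes> b = y [^] Suc k \<otimes> a \<oplus> y [^] k \<otimes> (y \<otimes> z) \<otimes> c"
    unfolding *(1) nat_pow_Suc using cl y(1,2) by algebra
  also have "\<dots> = y [^] Suc k \<otimes> a \<oplus> y [^] k \<otimes> c"
    using cl y by simp
  finally have "y [^] Suc k \<otimes> b = y [^] Suc k \<otimes> a \<oplus> y [^] k \<otimes> c" .
  moreover have "y [^] Suc k \<otimes> a \<in> poly_values I y (Suc k)"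
    using poly_values_times_power[OF y(1), of a 0 "Suc k"] *(2) by (simp del: poly_values.simps(2))
  moreover have "y [^] k \<otimes> c \<in> poly_values I y (Suc k)"
    using Suc.IH[OF *(3)] poly_values_mono[OF y(1)] by blast
  ultimately show ?case using poly_values_add[OF y(1)] by (simp del: poly_values.simps)
qed

text \<open>The hypothesis on \<open>\<one> \<ominus> a\<close> says that \<open>I\<close> lies in the Jacobson radical of \<open>V\<close>; it makes
  the relation of smaller degree monic, so that it lowers the degree of the other one.\<close>

lemma no_two_unit_relations:
  assumes one: "\<one> \<notin> I"
    and unit: "\<And>a. a \<in> I \<Longrightarrow> \<exists>v\<in>V. v \<otimes> (\<one> \<ominus> a) = \<one>"
    and yz: "y \<in> carrier R" "z \<in> carrier R" "y \<otimes> z = \<one>"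
    and p: "\<one> \<in> poly_values I y n" and r: "\<one> \<in> poly_values I z m"
  shows False
  using yz p r
proof (induction "n + m" arbitrary: n m y z rule: less_induct)
  case less
  \<comment> \<open>The roles of \<open>y\<close> and \<open>z\<close> are symmetric, so the
    relation in \<open>z\<close> may be taken to have the smaller degree.\<close>
  have main: False if le: "m' \<le> n'" and nm: "n' + m' = n + m"
    and y: "y \<in> carrier R" "z \<in> carrier R" "y \<otimes> z = \<one>"
    and py: "\<one> \<in> poly_values I y n'" and pz: "\<one> \<in> poly_values I z m'" for n' m' y z
  proof (cases m')
    case 0
    then show False using pz one by simp
  next
    case (Suc k)
    then obtain l where l: "n' = Suc l" "k \<le> l" using le by (cases n') auto
    obtain b c where bc: "\<one> = b \<oplus> z \<otimes> c" "b \<in> I" "c \<in> poly_values I z k"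
      using pz Suc by auto
    have cl: "b \<in> carrier R" "c \<in> carrier R"
      using bc y poly_values_closed[OF y(2)] I_closed by auto
    obtain v where v: "v \<in> V" "v \<otimes> (\<one> \<ominus> b) = \<one>" using unit bc by blast
    have vc: "v \<in> carrier R" using v V_carrier by simp
    \<comment> \<open>Dividing by the unit \<open>\<one> \<ominus> b\<close> and multiplying by
      \<open>y\<close> expresses \<open>y\<close> as a polynomial of degree at most
      \<open>k = m' - 1\<close> in \<open>z\<close>.\<close>
    have "\<one> \<ominus> b = (b \<oplus> z \<otimes> c) \<ominus> b" using bc(1) by simp
    also have "\<dots> = z \<otimes> c" using cl y(2) by algebra
    finally have "v \<otimes> (z \<otimes> c) = \<one>" using v by simp
    then have "y = y \<otimes> (v \<otimes> (z \<otimes> c))" using y by simp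
    also have "\<dots> = (y \<otimes> z) \<otimes> (v \<otimes> c)" using cl vc y(1,2) by algebra
    also have "\<dots> = v \<otimes> c" using y cl vc by simp
    finally have "y \<in> poly_values I z k" using poly_values_smult[OF y(2) v(1) bc(3)] by simp
    \<comment> \<open>Reversal gives \<open>y [^] Suc k\<close> as a polynomial in \<open>y\<close>
      of degree at most \<open>k\<close>; a shift by \<open>l - k\<close> then rewrites
      \<open>y [^] Suc l\<close>, the top power of the other relation, in lower degree.\<close>
    then have "y [^] k \<otimes> y \<in> poly_values I y k" using poly_values_reverse[OF y] by blast
    then have "y [^] (l - k) \<otimes> (y [^] k \<otimes> y) \<in> poly_values I y (l - k + k)"
      using poly_values_times_power[OF y(1)] by blast
    moreover have "y [^] (l - k) \<otimes> (y [^] k \<otimes> y) = y [^] (l - k + k) \<otimes> y"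
      using y(1) by (simp add: nat_pow_mult[symmetric] m_assoc)
    ultimately have yl: "y [^] Suc l \<in> poly_values I y l" using l by simp
    obtain r a where ra: "r \<in> poly_values I y l" "a \<in> I" "\<one> = r \<oplus> a \<otimes> y [^] Suc l"
      using poly_values_split_top[OF y(1)] py l by blast
    have "a \<otimes> y [^] Suc l \<in> poly_values I y l"
      using poly_values_smult[OF y(1) _ yl] ra(2) I_subset by blast
    then have "\<one> \<in> poly_values I y l" using ra poly_values_add[OF y(1)] by simp
    moreover have "l + m' < n + m" using l nm by simp
    ultimately show False using less(1)[OF _ y _ pz] by blast
  qed
  show False
  proof (cases "m \<le> n")
    case True
    then show False using main[OF _ _ less(2-6)] by simp
  next
    case False
    moreover have "z \<otimes> y = \<one>" using less m_comm by simp
    ultimately show False using main[OF _ _ less(3,2) _ less(6,5)] by simp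
  qed
qed

end


section \<open>Chevalley's extension to a valuation ring\<close>

context field
begin

lemma field_inv:
  assumes "a \<in> carrier R" "a \<noteq> \<zero>"
  shows "inv a \<in> carrier R" "a \<otimes> inv a = \<one>" "inv a \<otimes> a = \<one>" "inv a \<noteq> \<zero>"
proof -
  have "a \<in> Units R" using assms field_Units by simp
  then show "inv a \<in> carrier R" "a \<otimes> inv a = \<one>" "inv a \<otimes> a = \<one>" by auto
  then show "inv a \<noteq> \<zero>" using assms by auto
qed

lemma transcendental_nonzero:
  assumes K: "subring K R" and tr: "transcendental K x"
  shows "x \<noteq> \<zero>"
proof
  have tr': "(transcendental over K) x" using tr by (simp add: over_def)
  assume "x = \<zero>"
  \<comment> \<open>Coefficient lists start with the leading coefficient, so this list is the
    polynomial X.\<close>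
  then have "eval [\<one>, \<zero>] x = \<zero>" by simp
  moreover have "[\<one>, \<zero>] \<in> carrier (K[X])"
    using subringE(2,3)[OF K] unfolding univ_poly_carrier[symmetric] polynomial_def by simp
  ultimately show False using eval_transcendental[OF tr'] by blast
qed

lemma inv_notin_simple_extension:
  assumes K: "subring K R" and x: "x \<in> carrier R" and tr: "transcendental K x"
  shows "inv x \<notin> simple_extension K x"
proof
  assume "inv x \<in> simple_extension K x"
  then obtain p where p: "p \<in> carrier (K[X])" "inv x = eval p x"
    using simple_extension_as_eval_img[OF subringE(1)[OF K] x] by auto
  have tr': "(transcendental over K) x" using tr by (simp add: over_def)
  have x0: "x \<noteq> \<zero>" by (rule transcendental_nonzero[OF K tr])
  have pK: "set p \<subseteq> K" using p(1) polynomial_incl univ_poly_carrier by blast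
  then have pc: "set p \<subseteq> carrier R" using subringE(1)[OF K] by blast
  have "p \<noteq> []" using p(2) field_inv[OF x x0] by auto
  \<comment> \<open>If \<open>inv x = p(x)\<close>, then appending the constant term -1 to
    \<open>p\<close> gives X p(X) - 1, a nonzero polynomial that vanishes at
    \<open>x\<close>.\<close>
  then have "polynomial K (p @ [\<ominus> \<one>])"
    using p(1) pK subringE(3,5)[OF K] unfolding univ_poly_carrier[symmetric] polynomial_def by auto
  moreover have "eval (p @ [\<ominus> \<one>]) x = \<zero>"
    using eval_append_aux[OF pc _ x, of "\<ominus> \<one>"] p(2) field_inv[OF x x0] by (simp add: r_neg)
  ultimately show False using eval_transcendental[OF tr'] univ_poly_carrier by blast
qed

lemma chain_Union_subring:
  assumes ne: "\<C> \<noteq> {}" and chain: "subset.chain \<A> \<C>" and sub: "\<And>S. S \<in> \<A> \<Longrightarrow> subring S R"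
  shows "subring (\<Union>\<C>) R"
proof (rule subringI)
  have S: "subring S R" if "S \<in> \<C>" for S
    using that chain sub by (auto simp: subset.chain_def)
  have two: "\<exists>S\<in>\<C>. a \<in> S \<and> b \<in> S" if "a \<in> \<Union>\<C>" "b \<in> \<Union>\<C>" for a b
    using that chain unfolding subset.chain_def by blast
  show "\<Union>\<C> \<subseteq> carrier R" using S subringE(1) by blast
  show "\<one> \<in> \<Union>\<C>" using ne S subringE(3) by blast
  show "\<ominus> h \<in> \<Union>\<C>" if "h \<in> \<Union>\<C>" for h
    using that subringE(5)[OF S] by (meson UnionE UnionI)
  show "a \<otimes> b \<in> \<Union>\<C>" if "a \<in> \<Union>\<C>" "b \<in> \<Union>\<C>" for a b
    using two[OF that] subringE(6)[OF S] by (meson UnionI)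
  show "a \<oplus> b \<in> \<Union>\<C>" if "a \<in> \<Union>\<C>" "b \<in> \<Union>\<C>" for a b
    using two[OF that] subringE(7)[OF S] by (meson UnionI)
qed

text \<open>Zorn's lemma gives \<open>V\<close> maximal among the subrings containing
  \<open>S\<close> but not \<open>inv x\<close>. If neither \<open>y\<close> nor
  \<open>inv y\<close> were in \<open>V\<close>, then \<open>inv x\<close> would lie in V[y] and in
  V[1/y]. Multiplying by \<open>x\<close> would write 1 as a polynomial in \<open>y\<close> and as
  one in \<open>inv y\<close>, both with coefficients in xV, which
  \<open>no_two_unit_relations\<close> excludes.\<close>

lemma exists_valuation_ring:
  assumes S: "subring S R" and x: "x \<in> S" and x0: "x \<noteq> \<zero>" and nx: "inv x \<notin> S"
  shows "\<exists>V. subring V R \<and> S \<subseteq> V \<and> inv x \<notin> V \<and>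
    (\<forall>y\<in>carrier R - {\<zero>}. y \<in> V \<or> inv y \<in> V)"
proof -
  define \<A> where "\<A> = {V. subring V R \<and> S \<subseteq> V \<and> inv x \<notin> V}"
  have "S \<in> \<A>" using S nx by (simp add: \<A>_def)
  moreover have "\<Union>\<C> \<in> \<A>" if "\<C> \<noteq> {}" "subset.chain \<A> \<C>" for \<C>
  proof -
    have "\<C> \<subseteq> \<A>" using that(2) by (simp add: subset.chain_def)
    moreover have "subring (\<Union>\<C>) R"
      by (rule chain_Union_subring[OF that]) (simp add: \<A>_def)
    ultimately show ?thesis using that(1) by (auto simp: \<A>_def)
  qed
  ultimately obtain V where VA: "V \<in> \<A>" and max: "\<And>W. W \<in> \<A> \<Longrightarrow> V \<subseteq> W \<Longrightarrow> W = V"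
    using subset_Zorn_nonempty[of \<A>] by blast
  have VR: "subring V R" "S \<subseteq> V" "inv x \<notin> V" using VA by (auto simp: \<A>_def)
  have Vc: "v \<in> carrier R" if "v \<in> V" for v using that subringE(1)[OF VR(1)] by blast
  have xV: "x \<in> V" using x VR by blast
  have xc: "x \<in> carrier R" using xV Vc by simp
  \<comment> \<open>By maximality, adjoining any element outside \<open>V\<close> must bring in
    \<open>inv x\<close>.\<close>
  have ext: "inv x \<in> simple_extension V y" if "y \<in> carrier R" "y \<notin> V" for y
  proof (rule ccontr)
    assume "\<not> ?thesis"
    moreover have "subring (simple_extension V y) R" "V \<subseteq> simple_extension V y"
      "y \<in> simple_extension V y"
      using simple_extension_is_subring[OF VR(1) that(1)] simple_extension_mem[OF VR(1) that(1)]
        simple_extension_incl[OF subringE(1)[OF VR(1)] that(1)] by auto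
    ultimately have "simple_extension V y \<in> \<A>" "V \<subseteq> simple_extension V y"
      using VR by (auto simp: \<A>_def)
    then have "simple_extension V y = V" by (rule max)
    then show False using \<open>y \<in> simple_extension V y\<close> that by blast
  qed
  note xi = field_inv[OF xc x0]
  define I where "I = {x \<otimes> a | a. a \<in> V}"
  interpret submodule_of_subring R V I
  proof (intro submodule_of_subring.intro submodule_of_subring_axioms.intro)
    show "cring R" by (rule is_cring)
    show "subring V R" by (rule VR(1))
    show "I \<subseteq> V" using xV subringE(6)[OF VR(1)] by (auto simp: I_def)
    show "\<zero> \<in> I" unfolding I_def using subringE(2)[OF VR(1)] r_null[OF xc] by (intro CollectI exI[of _ "\<zero>"]) simp
    show "a \<oplus> b \<in> I" if ab: "a \<in> I" "b \<in> I" for a b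
    proof -
      obtain c d where "a = x \<otimes> c" "b = x \<otimes> d" "c \<in> V" "d \<in> V" using ab by (auto simp: I_def)
      then have "a \<oplus> b = x \<otimes> (c \<oplus> d)" "c \<oplus> d \<in> V"
        using xc Vc subringE(7)[OF VR(1)] by (auto simp: r_distr)
      then show ?thesis by (auto simp: I_def)
    qed
    show "v \<otimes> a \<in> I" if va: "v \<in> V" "a \<in> I" for v a
    proof -
      obtain c where "a = x \<otimes> c" "c \<in> V" using va by (auto simp: I_def)
      then have "v \<otimes> a = x \<otimes> (v \<otimes> c)" "v \<otimes> c \<in> V"
        using xc Vc va subringE(6)[OF VR(1)] by (auto simp: m_lcomm)
      then show ?thesis by (auto simp: I_def)
    qed
  qed
  have one: "\<one> \<notin> I"
  proof
    assume "\<one> \<in> I"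
    then obtain a where a: "a \<in> V" "\<one> = x \<otimes> a" by (auto simp: I_def)
    have ac: "a \<in> carrier R" using a(1) Vc by simp
    have "a = (inv x \<otimes> x) \<otimes> a" using xi ac by simp
    also have "\<dots> = inv x \<otimes> (x \<otimes> a)" using xi(1) xc ac by (simp add: m_assoc)
    also have "\<dots> = inv x" unfolding a(2)[symmetric] using xi(1) by simp
    finally show False using a(1) VR by simp
  qed
  have unit: "\<exists>v\<in>V. v \<otimes> (\<one> \<ominus> a) = \<one>" if aI: "a \<in> I" for a
  proof -
    obtain c where c: "a = x \<otimes> c" "c \<in> V" using aI by (auto simp: I_def)
    have cc: "c \<in> carrier R" using c Vc by simp
    define w where "w = \<one> \<ominus> a"
    have wc: "w \<in> carrier R" using c xc cc by (simp add: w_def)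
    have wV: "w \<in> V"
      unfolding w_def a_minus_def using aI I_subset subringE(3,5,7)[OF VR(1)] by blast
    have powV: "w [^] (k::nat) \<in> V" for k
      by (induction k) (use wV subringE(3,6)[OF VR(1)] in auto)
    have "w \<noteq> \<zero>"
    proof
      assume "w = \<zero>"
      then have "a = \<one>" using c xc cc r_right_minus_eq[of \<one> a] by (simp add: w_def)
      then show False using aI one by simp
    qed
    note wi = field_inv[OF wc this]
    \<comment> \<open>This puts xV inside the Jacobson radical. Otherwise \<open>inv x\<close> would
      be a polynomial in \<open>inv w\<close> over \<open>V\<close>; the next two steps clear the
      powers of \<open>w\<close> and reach \<open>inv x \<in> V\<close>.\<close>
    have "inv w \<in> V"
    proof (rule ccontr)
      assume "inv w \<notin> V"
      then have "inv x \<in> simple_extension V (inv w)" using ext wi by simp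
      moreover have "\<exists>k::nat. z \<otimes> w [^] k \<in> V \<and> z \<in> carrier R" if "z \<in> simple_extension V (inv w)" for z
        using that
      proof (induction rule: simple_extension.induct)
        case zero
        then show ?case using subringE(2)[OF VR(1)] wc by (intro exI[of _ 0]) simp
      next
        case (lin z v)
        then obtain k :: nat where k: "z \<otimes> w [^] k \<in> V" "z \<in> carrier R" by blast
        have vc: "v \<in> carrier R" "w [^] k \<in> carrier R" using lin Vc wc by auto
        have "(z \<otimes> inv w \<oplus> v) \<otimes> w [^] Suc k = z \<otimes> w [^] k \<otimes> (inv w \<otimes> w) \<oplus> v \<otimes> w [^] Suc k"
          unfolding nat_pow_Suc using wc wi(1) k(2) vc by algebra
        also have "\<dots> = z \<otimes> w [^] k \<oplus> v \<otimes> w [^] Suc k"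
          using wi k vc by simp
        also have "\<dots> \<in> V" using k lin powV subringE(6,7)[OF VR(1)] by blast
        finally show ?case using k vc wi by (intro exI[of _ "Suc k"]) simp
      qed
      ultimately obtain k :: nat where k: "inv x \<otimes> w [^] k \<in> V" by blast
      \<comment> \<open>Descent on the exponent: as \<open>w = 1 - xc\<close>, one has w^k/x =
        w^(k+1)/x + w^k c, and the last term is in \<open>V\<close>.\<close>
      have "inv x \<in> V" using k
      proof (induction k)
        case 0
        then show ?case using xi by simp
      next
        case (Suc k)
        have wk: "w [^] k \<in> carrier R" using wc by simp
        have "inv x \<otimes> w [^] k = inv x \<otimes> (w [^] k \<otimes> (\<one> \<ominus> x \<otimes> c)) \<oplus> (inv x \<otimes> x) \<otimes> (w [^] k \<otimes> c)"
          using xi(1) xc wk cc by algebra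
        also have "\<dots> = inv x \<otimes> w [^] Suc k \<oplus> w [^] k \<otimes> c"
          using xi wk cc c by (simp add: w_def)
        also have "\<dots> \<in> V" using Suc.prems c powV subringE(6,7)[OF VR(1)] by blast
        finally show ?case by (rule Suc.IH)
      qed
      then show False using VR by simp
    qed
    then show ?thesis using wi(3) by (auto simp: w_def)
  qed
  \<comment> \<open>Multiplication by \<open>x\<close> moves the coefficients from \<open>V\<close>
    into \<open>I\<close>; for \<open>z = inv x\<close> the product is 1.\<close>
  have rel: "\<exists>n. x \<otimes> z \<in> poly_values I y n \<and> z \<in> carrier R"
    if y: "y \<in> carrier R" and "z \<in> simple_extension V y" for y z
    using that(2)
  proof (induction rule: simple_extension.induct)
    case zero
    then show ?case using poly_values_zero[OF y, of 0] xc by (intro exI[of _ 0]) simp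
  next
    case (lin z v)
    then obtain n where n: "x \<otimes> z \<in> poly_values I y n" "z \<in> carrier R" by blast
    have "x \<otimes> (z \<otimes> y \<oplus> v) = x \<otimes> v \<oplus> y \<otimes> (x \<otimes> z)"
      using xc n y Vc lin by algebra
    moreover have "x \<otimes> v \<in> I" using lin by (auto simp: I_def)
    ultimately show ?case using n lin Vc y by (intro exI[of _ "Suc n"]) auto
  qed
  have "y \<in> V \<or> inv y \<in> V" if "y \<in> carrier R - {\<zero>}" for y
  proof (rule ccontr)
    assume neg: "\<not> ?thesis"
    have yc: "y \<in> carrier R" "y \<noteq> \<zero>" using that by auto
    note yi = field_inv[OF yc]
    obtain n m where "x \<otimes> inv x \<in> poly_values I y n" "x \<otimes> inv x \<in> poly_values I (inv y) m"
      using rel ext yc yi neg by meson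
    then show False using no_two_unit_relations[OF one unit yc(1) yi(1,2)] xi by simp
  qed
  then show ?thesis using VR by blast
qed

end

section \<open>Counting effective divisors\<close>

lemma finite_of_summable_const:
  fixes c :: complex
  assumes "(\<lambda>_. c) summable_on B" "c \<noteq> 0"
  shows "finite B"
proof (rule ccontr)
  assume "infinite B"
  moreover have "(\<lambda>_. norm c) summable_on B"
    using assms(1) by (simp add: summable_on_iff_abs_summable_on_complex)
  ultimately show False using infsum_diverge_constant[of B "norm c"] assms(2) by simp
qed

lemma powser_eq_0_imp_coeff_eq_0:
  fixes a :: "nat \<Rightarrow> complex"
  assumes r: "0 < r" and sums: "\<And>u. \<lbrakk>u \<noteq> 0; norm u < r\<rbrakk> \<Longrightarrow> (\<lambda>n. a n * u ^ n) sums 0"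
  shows "a m = 0"
proof (rule ccontr)
  assume m: "a m \<noteq> 0"
  \<comment> \<open>The shift multiplies the series by \<open>u\<close>. It supplies the sum at
    \<open>u = 0\<close>, about which nothing is assumed, and gives the nonzero coefficient the
    positive index \<open>Suc m\<close> that the theorem on isolated zeros requires.\<close>
  define b where "b = (\<lambda>n. case n of 0 \<Rightarrow> 0 | Suc k \<Rightarrow> a k)"
  have sm: "(\<lambda>n. b n * (u - 0) ^ n) sums 0" if "norm (u - 0) < r" for u
  proof (cases "u = 0")
    case True
    then have "(\<lambda>n. b n * (u - 0) ^ n) = (\<lambda>_. 0)"
      by (auto simp: b_def split: nat.splits)
    then show ?thesis by simp
  next
    case False
    then have "(\<lambda>n. u * (a n * u ^ n)) sums (u * 0)"
      using that by (intro sums_mult sums) auto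
    then have "(\<lambda>n. b (Suc n) * u ^ Suc n) sums 0"
      by (simp add: b_def mult_ac)
    then show ?thesis
      by (subst (asm) sums_Suc_iff) (simp add: b_def)
  qed
  show False
  proof (rule powser_0_nonzero[where a = b and \<xi> = 0 and f = "\<lambda>_. 0" and m = "Suc m", OF r sm])
    fix s :: real
    assume s: "0 < s" and nz: "\<And>z. z \<in> cball 0 s - {0 :: complex} \<Longrightarrow> (0::complex) \<noteq> 0"
    have "complex_of_real s \<in> cball 0 s - {0}" using s by simp
    then show False using nz by blast
  qed (use m in \<open>auto simp: b_def\<close>)
qed

text \<open>The number of elements with \<open>D A = n\<close> is the n-th coefficient of
  \<open>M\<close>, hence zero beyond the degree; the finitely many remaining level sets are finite
  by summability.\<close>

lemma finite_of_polynomial_generating_function: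
  fixes D :: "'b \<Rightarrow> nat" and M :: "complex poly"
  assumes r: "0 < r"
    and gen: "\<And>u. \<lbrakk>u \<noteq> 0; norm u < r\<rbrakk> \<Longrightarrow> ((\<lambda>A. u ^ D A) has_sum poly M u) E"
  shows "finite E"
proof -
  define B where "B n = {A \<in> E. D A = n}" for n
  have fin: "finite (B n)" for n
  proof -
    define u :: complex where "u = of_real (r / 2)"
    have u: "u \<noteq> 0" "norm u < r" using r by (auto simp: u_def)
    have "(\<lambda>A. u ^ D A) summable_on B n"
      using gen[OF u] summable_on_subset_banach[of _ E "B n"] by (auto simp: B_def summable_on_def)
    then have "(\<lambda>_. u ^ n) summable_on B n"
      by (rule summable_on_cong[THEN iffD1, rotated]) (simp add: B_def)
    then show ?thesis using finite_of_summable_const[of "u ^ n" "B n"] u by simp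
  qed
  have "of_nat (card (B n)) - coeff M n = (0 :: complex)" for n
  proof (rule powser_eq_0_imp_coeff_eq_0[OF r])
    fix u :: complex
    assume u: "u \<noteq> 0" "norm u < r"
    \<comment> \<open>Grouping the unordered sum by the value of \<open>D\<close> turns it into a
      power series in \<open>u\<close>.\<close>
    have bij: "bij_betw snd (Sigma UNIV B) E"
      by (rule bij_betwI[where g = "\<lambda>A. (D A, A)"]) (auto simp: B_def)
    have "((\<lambda>x. u ^ D (snd x)) has_sum poly M u) (Sigma UNIV B)"
      using gen[OF u] by (simp only: has_sum_reindex_bij_betw[OF bij, of "\<lambda>A. u ^ D A"])
    moreover have "((\<lambda>A. u ^ D (snd (n, A))) has_sum of_nat (card (B n)) * u ^ n) (B n)" for n
      using has_sum_constant[OF fin, of "u ^ n" n]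
      by (rule has_sum_cong[THEN iffD1, rotated]) (simp add: B_def)
    ultimately have "((\<lambda>n. of_nat (card (B n)) * u ^ n) has_sum poly M u) UNIV"
      by (rule has_sum_Sigma[where A = UNIV and B = B and f = "\<lambda>x. u ^ D (snd x)" and
            b = "\<lambda>n. of_nat (card (B n)) * u ^ n", OF isUCont_plus])
    then have "(\<lambda>n. of_nat (card (B n)) * u ^ n) sums poly M u"
      by (rule has_sum_imp_sums)
    moreover have "(\<lambda>n. coeff M n * u ^ n) sums poly M u"
      unfolding poly_altdef by (rule sums_finite) (auto simp: coeff_eq_0)
    ultimately show "(\<lambda>n. (of_nat (card (B n)) - coeff M n) * u ^ n) sums 0"
      using sums_diff by (fastforce simp: left_diff_distrib)
  qed
  then have "card (B n) = 0" if "degree M < n" for n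
    using that by (metis coeff_eq_0 diff_zero of_nat_eq_0_iff)
  then have "B n = {}" if "degree M < n" for n
    using that fin by auto
  then have "E \<subseteq> (\<Union>n\<le>degree M. B n)"
    by (fastforce simp: B_def not_le[symmetric])
  then show ?thesis
    by (rule finite_subset) (use fin in auto)
qed

lemma complex_of_real_poly_inject:
  "map_poly complex_of_real p = map_poly complex_of_real r \<longleftrightarrow> p = r"
  by (auto simp: poly_eq_iff coeff_map_poly)

text \<open>The half-plane Re s > 1 maps onto this punctured disc, so identities for the zeta series
  become identities in \<open>u\<close>.\<close>

lemma obtain_powr_eq:
  fixes q :: nat and u :: complex
  assumes q: "2 \<le> q" and u: "u \<noteq> 0" "norm u < 1 / real q"
  obtains s where "of_nat q powr (- s) = u" "Re s > 1" "1 - of_nat q * u \<noteq> 0" "1 - u \<noteq> 0"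
proof
  let ?s = "- Ln u / of_real (ln (real q))"
  have lnq: "ln (real q) > 0" using q by simp
  have Ln: "Ln (of_nat q) = complex_of_real (ln (real q))"
    using Ln_of_real[of "real q"] q by simp
  show "of_nat q powr (- ?s) = u"
    using u q lnq by (simp add: powr_def Ln)
  have "ln (norm u) < ln (1 / real q)" using u q by (subst ln_less_cancel_iff) auto
  then have "ln (real q) < - ln (norm u)" using q by (simp add: ln_div)
  then show "Re ?s > 1"
    using lnq u by (simp add: pos_divide_less_eq)
  have "norm (of_nat q * u) < 1" using u q by (simp add: norm_mult field_simps)
  then show "1 - of_nat q * u \<noteq> 0" by auto
  have "1 / real q \<le> 1" using q by simp
  then have "norm u < 1" using u by linarith
  then show "1 - u \<noteq> 0" by auto
qed

section \<open>Places and effective divisors\<close>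

lemma function_field_card_ge_2:
  assumes "function_field K F" "finite K"
  shows "2 \<le> card K"
proof -
  have K: "subfield K F" using assms(1) by (simp add: function_field_def)
  have "{\<zero>\<^bsub>F\<^esub>, \<one>\<^bsub>F\<^esub>} \<subseteq> K"
    using subringE(2,3)[OF subfieldE(1)[OF K]] by simp
  then have "card {\<zero>\<^bsub>F\<^esub>, \<one>\<^bsub>F\<^esub>} \<le> card K" using assms(2) card_mono by blast
  then show ?thesis using subfieldE(6)[OF K] by simp
qed

text \<open>For a transcendental \<open>x\<close>, a valuation ring containing K[x] but not
  \<open>inv x\<close> is a place: \<open>x\<close> makes it larger than \<open>K\<close>, and
  \<open>inv x\<close> makes it smaller than the whole field.\<close>

lemma places_nonempty:
  assumes "function_field K F"
  shows "places K F \<noteq> {}"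
proof -
  from assms obtain x where F: "field F" "subfield K F" and x: "x \<in> carrier F"
    "ring.transcendental F K x"
    by (auto simp: function_field_def)
  interpret field F by (rule F(1))
  note K = subfieldE(1)[OF F(2)]
  have x0: "x \<noteq> \<zero>\<^bsub>F\<^esub>" by (rule transcendental_nonzero[OF K x(2)])
  let ?S = "simple_extension K x"
  have S: "subring ?S F" "x \<in> ?S" "inv\<^bsub>F\<^esub> x \<notin> ?S" "K \<subseteq> ?S"
    using simple_extension_is_subring[OF K x(1)] simple_extension_mem[OF K x(1)]
      inv_notin_simple_extension[OF K x] simple_extension_incl[OF subringE(1)[OF K] x(1)]
    by auto
  then obtain V where V: "subring V F" "?S \<subseteq> V" "inv\<^bsub>F\<^esub> x \<notin> V"
    "\<forall>y\<in>carrier F - {\<zero>\<^bsub>F\<^esub>}. y \<in> V \<or> inv\<^bsub>F\<^esub> y \<in> V"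
    using exists_valuation_ring[OF S(1,2) x0 S(3)] by (elim exE conjE)
  have "x \<notin> K"
    using subfield_m_inv(1)[OF F(2), of x] x0 S(3,4) by auto
  then have "K \<subset> V" using V(2) S(2,4) by blast
  moreover have "V \<subset> carrier F"
    using V(3) subringE(1)[OF V(1)] field_inv(1)[OF x(1) x0] by auto
  ultimately have "V \<in> places K F" using V(1,4) by (simp add: places_def)
  then show ?thesis by blast
qed

lemma infinite_effective_divisors:
  assumes "function_field K F"
  shows "infinite (effective_divisors K F)"
proof -
  obtain P where P: "P \<in> places K F" using places_nonempty[OF assms] by blast
  define A where "A n = (\<lambda>V. if V = P then int n else 0)" for n
  have "inj A" by (rule injI) (metis A_def of_nat_eq_iff)
  moreover have "range A \<subseteq> effective_divisors K F"
  proof -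
    have "{V. A n V \<noteq> 0} \<subseteq> {P}" for n by (auto simp: A_def)
    then have "{V. A n V \<noteq> 0} \<subseteq> places K F" "finite {V. A n V \<noteq> 0}" for n
      using P finite_subset[of _ "{P}"] by blast+
    then show ?thesis by (auto simp: effective_divisors_def divisors_def A_def)
  qed
  ultimately show ?thesis by (meson infinite_super range_inj_infinite)
qed

text \<open>This turns the Dirichlet series into a power series in \<open>u\<close>. Effective
  divisors have nonnegative degree, so \<open>nat\<close> loses nothing, and the principal logarithm
  of a positive real is its real logarithm.\<close>

lemma divisor_norm_powr:
  assumes q: "2 \<le> card K" and A: "A \<in> effective_divisors K F"
  shows "of_real (divisor_norm K F A) powr (- s) =
    (of_nat (card K) powr (- s) :: complex) ^ nat (divisor_degree K F A)"
proof -
  let ?q = "real (card K)" and ?d = "nat (divisor_degree K F A)"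
  have "divisor_degree K F A \<ge> 0"
    using A unfolding divisor_degree_def effective_divisors_def by (auto intro!: sum_nonneg)
  then have norm: "divisor_norm K F A = ?q ^ ?d"
    by (simp add: divisor_norm_def power_int_def)
  have "Ln (of_real (?q ^ ?d)) = of_real (real ?d * ln ?q)"
    using q by (subst Ln_of_real) (auto simp: ln_realpow)
  moreover have "Ln (of_nat (card K)) = complex_of_real (ln ?q)"
    using Ln_of_real[of ?q] q by simp
  ultimately show ?thesis
    using q by (simp add: norm powr_def exp_of_nat_mult[symmetric] mult_ac del: of_real_power)
qed

section \<open>The numerator of the zeta function\<close>

text \<open>Two candidates agree on an infinite punctured disc. Uniqueness gives meaning to the
  definite description in \<open>L_polynomial\<close>.\<close>

lemma is_L_polynomial_unique:
  assumes q: "2 \<le> card K" and L: "is_L_polynomial K F L" "is_L_polynomial K F L'"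
  shows "L = L'"
proof -
  let ?q = "real (card K)"
  have eq: "poly (map_poly complex_of_real L) u = poly (map_poly complex_of_real L') u"
    if u: "u \<noteq> 0" "norm u < 1 / ?q" for u
  proof -
    obtain s where s: "of_nat (card K) powr (- s) = u" "Re s > 1"
      "1 - of_nat (card K) * u \<noteq> 0" "1 - u \<noteq> 0"
      using obtain_powr_eq[OF q u] by metis
    have "poly (map_poly complex_of_real L) u / ((1 - of_nat (card K) * u) * (1 - u)) =
        poly (map_poly complex_of_real L') u / ((1 - of_nat (card K) * u) * (1 - u))"
      using L s(1,2) unfolding is_L_polynomial_def Let_def by metis
    then show ?thesis using s(3,4) by simp
  qed
  have "map_poly complex_of_real L - map_poly complex_of_real L' = 0"
  proof (rule ccontr)
    assume "\<not> ?thesis"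
    then have "finite {u. poly (map_poly complex_of_real L - map_poly complex_of_real L') u = 0}"
      by (rule poly_roots_finite)
    moreover have "ball 0 (1 / ?q) - {0} \<subseteq> {u. poly (map_poly complex_of_real L - map_poly complex_of_real L') u = 0}"
      using eq by auto
    ultimately have "finite (ball (0::complex) (1 / ?q) - {0})" by (rule rev_finite_subset)
    then have "finite (ball (0::complex) (1 / ?q))" by simp
    moreover have "infinite (ball (0::complex) (1 / ?q))"
      using uncountable_ball[of "1 / ?q" "0::complex"] q countable_finite by fastforce
    ultimately show False by simp
  qed
  then show ?thesis using complex_of_real_poly_inject by simp
qed

text \<open>If both values were zero, the denominator would divide the numerator, and the remaining
  quotient \<open>M\<close> would be a polynomial generating function for the infinite set of
  effective divisors.\<close>

lemma L_polynomial_nonzero_at_poles: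
  assumes ff: "function_field K F" and fin: "finite K"
  defines "L \<equiv> map_poly complex_of_real (L_polynomial K F)"
  shows "poly L 1 \<noteq> 0 \<or> poly L (1 / of_nat (card K)) \<noteq> 0"
proof (rule ccontr)
  assume "\<not> ?thesis"
  then have zero: "poly L 1 = 0" "poly L (1 / of_nat (card K)) = 0" by auto
  let ?q = "of_nat (card K) :: complex"
  have q: "2 \<le> card K" by (rule function_field_card_ge_2[OF ff fin])
  have q': "?q \<noteq> 0" "1 / ?q \<noteq> 1" using q by auto
  \<comment> \<open>The default value 1 does not vanish at 1, so the \<open>else\<close> branch of
    the definition is ruled out.\<close>
  have "L_polynomial K F \<noteq> 1"
    using zero(1) by (auto simp: L_def)
  then have ex: "\<exists>L. is_L_polynomial K F L" by (metis L_polynomial_def)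
  then have isL: "is_L_polynomial K F (L_polynomial K F)"
    using ex is_L_polynomial_unique[OF q] theI'[of "is_L_polynomial K F"] unfolding L_polynomial_def by auto
  obtain A where A: "L = [:-1, 1:] * A" using zero(1) poly_eq_0_iff_dvd by (metis dvdE)
  have "poly L (1 / ?q) = (1 / ?q - 1) * poly A (1 / ?q)" by (simp add: A algebra_simps)
  then have "poly A (1 / ?q) = 0" using zero(2) q'(2) by (metis mult_eq_0_iff right_minus_eq)
  then obtain B where B: "A = [:- (1 / ?q), 1:] * B" using poly_eq_0_iff_dvd by (metis dvdE)
  \<comment> \<open>The scalar comes from (u - 1)(u - 1/q) = (1 - u)(1 - qu)/q.\<close>
  define M where "M = smult (1 / ?q) B"
  have L_eq: "poly L u = (1 - ?q * u) * (1 - u) * poly M u" for u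
    unfolding A B M_def using q' by (simp add: field_simps)
  have "finite (effective_divisors K F)"
  proof (rule finite_of_polynomial_generating_function)
    show "0 < 1 / real (card K)" using q by simp
    fix u :: complex
    assume u: "u \<noteq> 0" "norm u < 1 / real (card K)"
    obtain s where s: "?q powr (- s) = u" "Re s > 1" and nz: "1 - ?q * u \<noteq> 0" "1 - u \<noteq> 0"
      using obtain_powr_eq[OF q u] by metis
    have "(\<lambda>A. of_real (divisor_norm K F A) powr (- s)) summable_on effective_divisors K F"
      "zeta_series K F s = poly L u / ((1 - ?q * u) * (1 - u))"
      using isL s unfolding is_L_polynomial_def L_def Let_def by auto
    then have "((\<lambda>A. of_real (divisor_norm K F A) powr (- s)) has_sum poly M u) (effective_divisors K F)"
      using has_sum_infsum nz L_eq by (fastforce simp: zeta_series_def)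
    then show "((\<lambda>A. u ^ nat (divisor_degree K F A)) has_sum poly M u) (effective_divisors K F)"
      by (rule has_sum_cong[THEN iffD1, rotated]) (simp add: divisor_norm_powr[OF q] s(1))
  qed
  then show False using infinite_effective_divisors[OF ff] by simp
qed

section \<open>Convergence of meromorphic functions\<close>

text \<open>An entire function has no principal parts to contribute. Its vanishing at the poles of
  \<open>f\<close> preserves the canonical value 0 there.\<close>

lemma nicely_meromorphic_on_diff_analytic:
  assumes f: "f nicely_meromorphic_on UNIV" and e: "e analytic_on UNIV"
    and zero: "\<And>z. is_pole f z \<Longrightarrow> e z = 0"
  shows "(\<lambda>z. f z - e z) nicely_meromorphic_on UNIV"
    and "is_pole (\<lambda>z. f z - e z) z \<longleftrightarrow> is_pole f z"
    and "fls_prpart (laurent_expansion (\<lambda>z. f z - e z) z) = fls_prpart (laurent_expansion f z)"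
proof -
  have fm: "f meromorphic_on UNIV" using f by (simp add: nicely_meromorphic_on_def)
  have main: "fls_prpart (laurent_expansion (\<lambda>z. f z - e z) z) = fls_prpart (laurent_expansion f z) \<and>
     (is_pole (\<lambda>z. f z - e z) z \<longleftrightarrow> is_pole f z)" for z
  proof -
    have "isolated_singularity_at f z" "not_essential f z"
      using fm meromorphic_on_isolated_singularity meromorphic_on_not_essential
      by (metis UNIV_I empty_subsetI insert_subset meromorphic_on_subset)+
    then have F: "(\<lambda>x. f (z + x)) has_laurent_expansion laurent_expansion f z"
      by (rule not_essential_has_laurent_expansion)
    have "e analytic_on {z}" using e analytic_on_subset by blast
    then have "(\<lambda>x. e (z + x)) has_laurent_expansion fps_to_fls (fps_expansion e z)"
      by (intro has_laurent_expansion_fps analytic_at_imp_has_fps_expansion)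
    then have G: "(\<lambda>x. f (z + x) - e (z + x)) has_laurent_expansion
        laurent_expansion f z - fps_to_fls (fps_expansion e z)"
      by (rule has_laurent_expansion_diff[OF F])
    have eq: "fls_prpart (laurent_expansion f z - fps_to_fls (fps_expansion e z)) =
        fls_prpart (laurent_expansion f z)"
      by (simp add: fls_prpart_eq0_iff fls_subdegree_fls_to_fps_gt0)
    moreover have "laurent_expansion (\<lambda>z. f z - e z) z =
        laurent_expansion f z - fps_to_fls (fps_expansion e z)"
      by (rule laurent_expansion_eqI) (rule G)
    moreover have "is_pole (\<lambda>z. f z - e z) z \<longleftrightarrow>
        fls_prpart (laurent_expansion f z - fps_to_fls (fps_expansion e z)) \<noteq> 0"
      using has_laurent_expansion_imp_is_pole_iff[of "\<lambda>z. f z - e z", OF G]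
      by (simp only: fls_prpart_eq0_iff not_le)
    moreover have "is_pole f z \<longleftrightarrow> fls_prpart (laurent_expansion f z) \<noteq> 0"
      using has_laurent_expansion_imp_is_pole_iff[OF F]
      by (simp only: fls_prpart_eq0_iff not_le)
    ultimately show ?thesis by simp
  qed
  then show pole: "is_pole (\<lambda>z. f z - e z) z \<longleftrightarrow> is_pole f z" for z by blast
  show "fls_prpart (laurent_expansion (\<lambda>z. f z - e z) z) = fls_prpart (laurent_expansion f z)"
    using main by blast
  show "(\<lambda>z. f z - e z) nicely_meromorphic_on UNIV"
    unfolding nicely_meromorphic_on_def
  proof (intro conjI ballI)
    show "(\<lambda>z. f z - e z) meromorphic_on UNIV"
      by (rule meromorphic_on_diff[OF fm analytic_on_imp_meromorphic_on[OF e]])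
    fix z :: complex
    show "is_pole (\<lambda>z. f z - e z) z \<and> f z - e z = 0 \<or> (\<lambda>z. f z - e z) \<midarrow>z\<rightarrow> f z - e z"
    proof (cases "is_pole f z")
      case True
      then show ?thesis using pole is_pole_zero_at_nicely_mero[OF f] zero by simp
    next
      case False
      then have "f \<midarrow>z\<rightarrow> f z" using f by (auto simp: nicely_meromorphic_on_def)
      moreover have "e \<midarrow>z\<rightarrow> e z"
        using e analytic_at_imp_isCont analytic_on_subset isContD by blast
      ultimately show ?thesis by (intro disjI2 tendsto_diff)
    qed
  qed
qed

text \<open>Principal parts never change, and the difference \<open>- c n * e\<close> tends to 0
  uniformly on compact sets because \<open>e\<close> is bounded on each of them.\<close>

lemma mero_converges_diff_analytic:
  assumes f: "f \<in> mero_space" and e: "e analytic_on UNIV"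
    and zero: "\<And>z. is_pole f z \<Longrightarrow> e z = 0" and c: "c \<longlonglongrightarrow> 0"
  shows "mero_converges (\<lambda>n z. f z - c n * e z) f"
  unfolding mero_converges_def
proof (intro allI impI conjI)
  fix C :: "complex set"
  assume C: "compact C"
  have ce: "(\<lambda>z. a * e z) analytic_on UNIV" for a
    using e by (intro analytic_intros)
  note diff = nicely_meromorphic_on_diff_analytic[OF f[unfolded mero_space_def mem_Collect_eq] ce]
  show "\<forall>\<^sub>F n in sequentially. \<forall>z\<in>C. (is_pole (\<lambda>z. f z - c n * e z) z \<longleftrightarrow> is_pole f z) \<and>
      fls_prpart (laurent_expansion (\<lambda>z. f z - c n * e z) z) = fls_prpart (laurent_expansion f z)"
    using diff(2,3) zero by (intro always_eventually) simp
  have rs: "remove_sings (\<lambda>z. f z - c n * e z - f z) = (\<lambda>z. - c n * e z)" for n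
  proof
    fix z
    have "(\<lambda>z. - c n * e z) analytic_on {z}" using ce analytic_on_subset by blast
    then show "remove_sings (\<lambda>z. f z - c n * e z - f z) z = - c n * e z" by simp
  qed
  have "continuous_on C e"
    using e by (meson analytic_imp_holomorphic analytic_on_subset holomorphic_on_imp_continuous_on subset_UNIV)
  then have "bounded (e ` C)" using C compact_continuous_image compact_imp_bounded by blast
  then obtain B where B: "0 < B" "\<And>z. z \<in> C \<Longrightarrow> norm (e z) \<le> B"
    unfolding bounded_pos by auto
  show "uniform_limit C (\<lambda>n. remove_sings (\<lambda>z. f z - c n * e z - f z)) (\<lambda>_. 0) sequentially"
    unfolding rs
  proof (rule uniform_limitI)
    fix \<epsilon> :: real
    assume "0 < \<epsilon>"
    then have "\<forall>\<^sub>F n in sequentially. dist (c n) 0 < \<epsilon> / B"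
      using c B by (intro tendstoD) auto
    then show "\<forall>\<^sub>F n in sequentially. \<forall>z\<in>C. dist (- c n * e z) 0 < \<epsilon>"
    proof (rule eventually_mono, intro ballI)
      fix n z
      assume n: "dist (c n) 0 < \<epsilon> / B" and z: "z \<in> C"
      have "norm (c n) * norm (e z) \<le> norm (c n) * B"
        using B(2)[OF z] by (intro mult_left_mono) auto
      also have "\<dots> < \<epsilon>" using n B(1) by (simp add: pos_less_divide_eq)
      finally show "dist (- c n * e z) 0 < \<epsilon>" by (simp add: norm_mult)
    qed
  qed
qed

text \<open>The constant \<open>0\<close> must be excluded: it violates the Riemann hypothesis, but nearby functions
  need not.\<close>

lemma mero_open_not_riemann_hypothesis:
  "mero_open {f \<in> mero_space. (\<exists>s. f s \<noteq> 0) \<and> \<not> riemann_hypothesis f}" (is "mero_open ?U")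
  unfolding mero_open_def
proof (intro conjI allI impI)
  show "?U \<subseteq> mero_space" by blast
  fix g f
  assume "range g \<subseteq> mero_space \<and> f \<in> ?U \<and> mero_converges g f"
  then have g: "\<And>n. g n nicely_meromorphic_on UNIV" and f: "f nicely_meromorphic_on UNIV"
    and nz: "\<exists>s. f s \<noteq> 0" and nRH: "\<not> riemann_hypothesis f" and conv: "mero_converges g f"
    by (auto simp: mero_space_def)
  obtain s where s: "f s = 0" "\<not> is_pole f s" "Re s \<noteq> 1 / 2"
    using nRH by (auto simp: riemann_hypothesis_def zero_at_def)
  obtain S where S: "open S" "s \<in> S" "f holomorphic_on S"
    using nicely_meromorphic_on_imp_analytic_at[OF f _ s(2)] analytic_at by blast
  \<comment> \<open>A meromorphic function whose zeros accumulate at \<open>s\<close> vanishes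
    identically.\<close>
  have "\<not> (\<exists>\<^sub>F z in at s. f z = 0)"
  proof
    assume "\<exists>\<^sub>F z in at s. f z = 0"
    then have "f w = 0" for w
      by (rule frequently_eq_meromorphic_imp_constant[OF _ f]) auto
    then show False using nz by blast
  qed
  then have "\<forall>\<^sub>F z in at s. f z \<noteq> 0" by (simp add: not_frequently)
  then obtain T where T: "open T" "s \<in> T" "\<And>z. z \<in> T \<Longrightarrow> z \<noteq> s \<Longrightarrow> f z \<noteq> 0"
    unfolding eventually_at_topological by blast
  have "open {z. Re z \<noteq> 1 / 2}" by (intro open_Collect_neq continuous_intros)
  then have "open (S \<inter> T \<inter> {z. Re z \<noteq> 1 / 2})" using S T by auto
  moreover have "s \<in> S \<inter> T \<inter> {z. Re z \<noteq> 1 / 2}" using S T s by auto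
  \<comment> \<open>On this closed disc \<open>f\<close> is holomorphic, \<open>s\<close> is its
    only zero, and the critical axis is avoided.\<close>
  ultimately obtain r where r: "0 < r" "cball s r \<subseteq> S \<inter> T \<inter> {z. Re z \<noteq> 1 / 2}"
    using open_contains_cball by blast
  have np: "\<not> is_pole f z" if "z \<in> cball s r" for z
    using not_is_pole_holomorphic[OF S(1) _ S(3)] that r by blast
  have "sphere s r \<noteq> {}" using r by simp
  moreover have "continuous_on (sphere s r) (\<lambda>z. norm (f z))"
    using r S by (intro continuous_intros holomorphic_on_imp_continuous_on[OF holomorphic_on_subset[OF S(3)]]) auto
  ultimately obtain w where w: "w \<in> sphere s r" "\<And>z. z \<in> sphere s r \<Longrightarrow> norm (f w) \<le> norm (f z)"
    using continuous_attains_inf[OF compact_sphere] by blast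
  have wT: "w \<in> T" "w \<noteq> s" using w r by auto
  \<comment> \<open>Half the minimum of the modulus of \<open>f\<close> on the boundary
    circle.\<close>
  define m where "m = norm (f w) / 2"
  have m: "m > 0" using T(3)[OF wT] by (simp add: m_def)
  have "compact (cball s r)" by simp
  then have poles: "\<forall>\<^sub>F n in sequentially. \<forall>z\<in>cball s r. (is_pole (g n) z \<longleftrightarrow> is_pole f z) \<and>
      fls_prpart (laurent_expansion (g n) z) = fls_prpart (laurent_expansion f z)"
    and unif: "uniform_limit (cball s r) (\<lambda>n. remove_sings (\<lambda>z. g n z - f z)) (\<lambda>_. 0) sequentially"
    using conv unfolding mero_converges_def by blast+
  show "\<forall>\<^sub>F n in sequentially. g n \<in> ?U"
    using poles uniform_limitD[OF unif m]
  proof eventually_elim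
    case (elim n)
    have an: "g n analytic_on {z}" "norm (g n z - f z) < m" if z: "z \<in> cball s r" for z
    proof -
      show gz: "g n analytic_on {z}"
        using elim(1) np z nicely_meromorphic_on_imp_analytic_at[OF g] by blast
      have "f analytic_on {z}"
        using np z nicely_meromorphic_on_imp_analytic_at[OF f] by blast
      with gz have "(\<lambda>z. g n z - f z) analytic_on {z}" by (intro analytic_intros)
      then show "norm (g n z - f z) < m" using elim(2) z by fastforce
    qed
    have hol: "g n holomorphic_on cball s r"
      using an(1) analytic_imp_holomorphic analytic_on_analytic_at by blast
    \<comment> \<open>For \<open>g n\<close> within \<open>m\<close> of \<open>f\<close>, the
      modulus is below \<open>m\<close> at the centre, where \<open>f\<close> vanishes, and above
      \<open>m\<close> on the circle. A holomorphic function with a smaller modulus at the centre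
      than on the circle has a zero inside.\<close>
    obtain z where z: "z \<in> ball s r" "g n z = 0"
    proof (rule holomorphic_contract_to_zero)
      show "continuous_on (cball s r) (g n)" using hol by (rule holomorphic_on_imp_continuous_on)
      show "g n holomorphic_on ball s r" using hol holomorphic_on_subset ball_subset_cball by blast
      show "0 < r" by (rule r(1))
      fix z assume z: "norm (s - z) = r"
      have "norm (g n s) < m" using an(2)[of s] s(1) r(1) by simp
      moreover have "2 * m \<le> norm (f z)" using w(2)[of z] z by (simp add: m_def dist_norm)
      moreover have "norm (g n z - f z) < m" using an(2)[of z] z by (simp add: dist_norm)
      moreover have "norm (f z) - norm (g n z) \<le> norm (g n z - f z)"
        by (metis norm_minus_commute norm_triangle_ineq2)
      ultimately show "norm (g n s) < norm (g n z)" by linarith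
    qed
    have "z \<in> cball s r" using z by auto
    then have "\<not> is_pole (g n) z" "Re z \<noteq> 1 / 2"
      using elim(1) np r(2) by blast+
    then have "zero_at (g n) z" "Re z \<noteq> 1 / 2"
      using z(2) by (simp_all add: zero_at_def)
    then have "\<not> riemann_hypothesis (g n)" by (auto simp: riemann_hypothesis_def)
    \<comment> \<open>The boundary point \<open>w\<close> witnesses that \<open>g n\<close> is not
      identically zero: \<open>f w\<close> has modulus \<open>2 * m\<close>.\<close>
    moreover have "g n w \<noteq> 0"
      using an(2)[of w] w(1) m by (auto simp: m_def)
    ultimately show ?case using g by (auto simp: mero_space_def)
  qed
qed

section \<open>Perturbing rational numerators\<close>

definition pole_factor :: "nat \<Rightarrow> complex \<Rightarrow> complex" where
  "pole_factor q u = (1 - u) * (1 - of_nat q * u) / u"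

text \<open>With w for \<open>pole_factor\<close>, this is the function of \<open>s\<close> whose
  numerator is u^g w^(k+1): one factor w cancels the denominator and leaves 1/u. The cancelled form
  is entire in \<open>s\<close>.\<close>

definition bump :: "nat \<Rightarrow> nat \<Rightarrow> nat \<Rightarrow> complex \<Rightarrow> complex" where
  "bump q g k s = (let u = of_nat q powr (- s) in u ^ g * pole_factor q u ^ k / u)"

lemma pole_factor_reflect:
  assumes "u \<noteq> 0" "q \<noteq> 0"
  shows "pole_factor q (1 / (of_nat q * u)) = pole_factor q u"
  using assms by (simp add: pole_factor_def field_simps)

lemma cnj_of_nat_powr: "cnj (of_nat q powr s) = of_nat q powr cnj s"
  by (subst cnj_powr) auto

lemma cnj_bump: "cnj (bump q g k s) = bump q g k (cnj s)"
  by (simp add: bump_def pole_factor_def Let_def cnj_of_nat_powr)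

lemma analytic_bump:
  assumes "q \<noteq> 0"
  shows "bump q g k analytic_on UNIV"
proof -
  have "bump q g k holomorphic_on UNIV"
    unfolding bump_def pole_factor_def Let_def using assms
    by (intro holomorphic_intros) auto
  then show ?thesis by (simp add: analytic_on_open)
qed

text \<open>With \<open>Suc k\<close> one factor w always survives the cancellation. These are the
  only points where functions of the class can have poles, so subtracting a multiple keeps canonical
  representatives.\<close>

lemma bump_eq_0:
  assumes "of_nat q powr (- s) = 1 \<or> of_nat q * of_nat q powr (- s) = (1 :: complex)"
  shows "bump q g (Suc k) s = 0"
  using assms by (auto simp: bump_def pole_factor_def Let_def)

lemma bump_eq_quotient:
  fixes s :: complex
  assumes "q \<noteq> 0"
  defines "u \<equiv> of_nat q powr (- s)"
  assumes "u \<noteq> 1" "of_nat q * u \<noteq> 1"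
  shows "bump q g k s = u ^ g * pole_factor q u ^ Suc k / ((1 - u) * (1 - of_nat q * u))"
proof -
  have "u \<noteq> 0" using assms(1) by (simp add: u_def)
  then have "1 / u = pole_factor q u / ((1 - u) * (1 - of_nat q * u))"
    using assms(3,4) by (simp add: pole_factor_def)
  then have "u ^ g * pole_factor q u ^ k * (1 / u) =
      u ^ g * pole_factor q u ^ k * (pole_factor q u / ((1 - u) * (1 - of_nat q * u)))"
    by (rule arg_cong)
  then show ?thesis by (simp add: bump_def Let_def u_def[symmetric] mult_ac)
qed

lemma not_is_pole_has_numerator:
  assumes q: "q \<noteq> 0" and h: "h holomorphic_on - {0}" and f: "has_numerator q f h"
    and s: "of_nat q powr (- s) \<noteq> (1 :: complex)" "of_nat q * of_nat q powr (- s) \<noteq> (1 :: complex)"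
  shows "\<not> is_pole f s"
proof -
  let ?u = "\<lambda>s. of_nat q powr (- s) :: complex"
  define S where "S = {s. ?u s \<noteq> 1 \<and> of_nat q * ?u s \<noteq> 1}"
  have cont: "continuous_on UNIV ?u" using q by (intro continuous_intros) auto
  have "open S"
    unfolding S_def
    by (intro open_Collect_conj open_Collect_neq continuous_on_mult cont continuous_on_const)
  moreover have "s \<in> S" using s by (simp add: S_def)
  moreover have "f holomorphic_on S"
  proof (rule holomorphic_transform)
    have "(h \<circ> ?u) holomorphic_on S"
      by (rule holomorphic_on_compose_gen[OF _ h]) (use q in \<open>auto intro!: holomorphic_intros\<close>)
    then show "(\<lambda>s. h (?u s) / ((1 - ?u s) * (1 - of_nat q * ?u s))) holomorphic_on S"
      using q by (intro holomorphic_intros) (auto simp: S_def o_def)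
    show "h (?u s) / ((1 - ?u s) * (1 - of_nat q * ?u s)) = f s" if "s \<in> S" for s
      using f that by (simp add: has_numerator_def S_def Let_def)
  qed
  ultimately show ?thesis by (rule not_is_pole_holomorphic)
qed

lemma has_numerator_diff_bump:
  assumes "q \<noteq> 0" "has_numerator q f h"
  shows "has_numerator q (\<lambda>s. f s - c * bump q g k s)
    (\<lambda>u. h u - c * (u ^ g * pole_factor q u ^ Suc k))"
  unfolding has_numerator_def Let_def
proof (intro allI impI, elim conjE)
  fix s
  assume s: "of_nat q powr (- s) \<noteq> (1 :: complex)" "of_nat q * of_nat q powr (- s) \<noteq> (1 :: complex)"
  have f: "f s = h (of_nat q powr (- s)) /
      ((1 - of_nat q powr (- s)) * (1 - of_nat q * of_nat q powr (- s)))"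
    using assms(2) s by (simp add: has_numerator_def Let_def)
  show "f s - c * bump q g k s = (h (of_nat q powr (- s)) -
      c * ((of_nat q powr (- s)) ^ g * pole_factor q (of_nat q powr (- s)) ^ Suc k)) /
      ((1 - of_nat q powr (- s)) * (1 - of_nat q * of_nat q powr (- s)))"
    unfolding f bump_eq_quotient[OF assms(1) s] by (simp add: diff_divide_distrib)
qed

lemma interpolates_L_diff_bump:
  assumes "card K \<noteq> 0" "interpolates_L K F h"
  shows "interpolates_L K F (\<lambda>u. h u - c * (u ^ g * pole_factor (card K) u ^ Suc k))"
  using assms by (simp add: interpolates_L_def Let_def pole_factor_def)

lemma rational_without_poles_on_diff_bump:
  assumes "rational_without_poles_on R (- {0})"
  shows "rational_without_poles_on (\<lambda>u. R u - c * (u ^ g * pole_factor q u ^ k)) (- {0})"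
proof -
  obtain p d where pd: "\<And>u. u \<noteq> 0 \<Longrightarrow> poly d u \<noteq> 0 \<and> R u = poly p u / poly d u"
    using assms by (auto simp: rational_without_poles_on_def)
  define b where "b = [:1, -1:] * [:1, - of_nat q :: complex:]"
  define a where "a = [:0, 1:] ^ g * b ^ k"
  have "R u - c * (u ^ g * pole_factor q u ^ k) =
      poly (p * [:0, 1:] ^ k - smult c (d * a)) u / poly (d * [:0, 1:] ^ k) u \<and>
      poly (d * [:0, 1:] ^ k) u \<noteq> 0" if "u \<noteq> 0" for u
  proof -
    have "poly b u = (1 - u) * (1 - of_nat q * u)"
      by (simp add: b_def algebra_simps)
    then have "u ^ g * pole_factor q u ^ k = poly a u / u ^ k"
      by (simp add: a_def pole_factor_def power_divide)
    then show ?thesis using pd[OF that] that by (simp add: field_simps)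
  qed
  then show ?thesis unfolding rational_without_poles_on_def by blast
qed

text \<open>The subtracted numerator satisfies the homogeneous versions of the conditions: it
  vanishes at 1 and 1/q, division by u^g leaves a power of the invariant w, and a real
  \<open>c\<close> respects conjugation.\<close>

lemma R_class_diff_bump:
  assumes q: "card K \<noteq> 0" and f: "f \<in> R_class K F" and c: "cnj c = c"
    and f': "(\<lambda>s. f s - c * bump (card K) (genus K F) (Suc k) s) \<in> mero_space"
  shows "(\<lambda>s. f s - c * bump (card K) (genus K F) (Suc k) s) \<in> R_class K F"
proof -
  let ?q = "card K" and ?g = "genus K F"
  let ?f' = "\<lambda>s. f s - c * bump ?q ?g (Suc k) s"
  let ?E = "\<lambda>u. u ^ ?g * pole_factor ?q u ^ Suc (Suc k)"
  \<comment> \<open>The numerators \<open>h\<close> and \<open>R\<close> come from separate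
    existential statements, so the same perturbation is applied to each.\<close>
  from f obtain h R where h: "h holomorphic_on - {0}" "has_numerator ?q f h" "interpolates_L K F h"
      "\<And>u. u \<noteq> 0 \<Longrightarrow> u powi (- int ?g) * h u =
        (1 / (of_nat ?q * u)) powi (- int ?g) * h (1 / (of_nat ?q * u))"
    and sym: "\<And>s. f s = cnj (f (cnj s))"
    and R: "rational_without_poles_on R (- {0})" "has_numerator ?q f R" "interpolates_L K F R"
    unfolding R_class_def M_class_def Let_def by blast
  have E: "u powi (- int ?g) * (h u - c * ?E u) =
      u powi (- int ?g) * h u - c * pole_factor ?q u ^ Suc (Suc k)" if "u \<noteq> 0" for u
    using that by (simp add: power_int_minus field_simps)
  have "(\<lambda>u. h u - c * ?E u) holomorphic_on - {0}"
    unfolding pole_factor_def using h(1) by (intro holomorphic_intros) auto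
  moreover have "u powi (- int ?g) * (h u - c * ?E u) =
      (1 / (of_nat ?q * u)) powi (- int ?g) *
        (h (1 / (of_nat ?q * u)) - c * ?E (1 / (of_nat ?q * u)))" if "u \<noteq> 0" for u
  proof -
    have "1 / (of_nat ?q * u) \<noteq> 0" using q that by simp
    from E[OF this] E[OF that] show ?thesis
      by (simp only: h(4)[OF that] pole_factor_reflect[OF that q])
  qed
  moreover have "?f' s = cnj (?f' (cnj s))" for s
    using sym[of s] c by (simp add: cnj_bump)
  ultimately have "?f' \<in> M_class K F"
    unfolding M_class_def Let_def
    using f' has_numerator_diff_bump[OF q h(2)] interpolates_L_diff_bump[OF q h(3)] by blast
  then show ?thesis
    unfolding R_class_def
    using rational_without_poles_on_diff_bump[OF R(1)] has_numerator_diff_bump[OF q R(2)]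
      interpolates_L_diff_bump[OF q R(3)] by blast
qed

lemma of_nat_powr_of_nat:
  assumes "q \<noteq> 0"
  shows "of_nat q powr (- (- of_nat n)) = (of_nat q ^ n :: complex)"
  using assms by (simp add: powr_complexpow)

text \<open>At \<open>s = -n\<close> one has \<open>u = q^n\<close>, and the quotient equals R(u) /
  (u^g w^(k+2)), a rational function of \<open>u\<close>. Since w grows linearly at infinity, a
  large \<open>k\<close> makes its degree negative.\<close>

lemma quotient_bump_tendsto_0:
  assumes q: "2 \<le> q" and R: "rational_without_poles_on R (- {0})" and f: "has_numerator q f R"
  shows "\<exists>k. (\<lambda>n. f (- of_nat n) / bump q g (Suc k) (- of_nat n)) \<longlonglongrightarrow> 0"
proof -
  obtain p d where pd: "\<And>u. u \<noteq> 0 \<Longrightarrow> poly d u \<noteq> 0 \<and> R u = poly p u / poly d u"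
    using R by (auto simp: rational_without_poles_on_def)
  have q0: "q \<noteq> 0" using q by simp
  \<comment> \<open>Writing w = b/u with \<open>b\<close> of degree 2, the comparison requires deg p
    < deg d + g + k + 2, which \<open>k = degree p\<close> guarantees.\<close>
  define k where "k = degree p"
  define b where "b = [:1, -1:] * [:1, - of_nat q :: complex:]"
  define P where "P = p * [:0, 1:] ^ Suc (Suc k)"
  define Q where "Q = d * [:0, 1:] ^ g * b ^ Suc (Suc k)"
  have "d \<noteq> 0" using pd[of 1] by auto
  moreover have b: "b \<noteq> 0" "degree b = 2" using q0 by (auto simp: b_def degree_mult_eq)
  ultimately have "degree Q = degree d + g + Suc (Suc k) * 2"
    by (simp add: Q_def degree_mult_eq degree_power_eq del: power_Suc)
  moreover have "degree P \<le> degree p + Suc (Suc k)"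
    unfolding P_def by (rule order_trans[OF degree_mult_le]) (simp add: degree_power_eq del: power_Suc)
  ultimately have "degree P < degree Q" by (simp add: k_def)
  then have "((\<lambda>u. poly P u / poly Q u) \<longlongrightarrow> 0) at_infinity"
    by (rule poly_divide_tendsto_0_at_infinity)
  moreover have "filterlim (\<lambda>n. of_nat q ^ n :: complex) at_infinity sequentially"
    using q by (intro filterlim_realpow_sequentially_gt1) simp
  ultimately have lim: "(\<lambda>n. poly P (of_nat q ^ n) / poly Q (of_nat q ^ n)) \<longlonglongrightarrow> 0"
    by (rule filterlim_compose)
  have "\<forall>\<^sub>F n in sequentially. poly P (of_nat q ^ n) / poly Q (of_nat q ^ n) =
      f (- of_nat n) / bump q g (Suc k) (- of_nat n)"
    \<comment> \<open>At \<open>n = 0\<close> one would have \<open>u = 1\<close>, a zero of the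
      denominator.\<close>
    using eventually_ge_at_top[of 1]
  proof eventually_elim
    case (elim n)
    define u :: complex where "u = of_nat q ^ n"
    have "q ^ n \<noteq> 1" "q * q ^ n \<noteq> 1" using q elim by auto
    then have u: "u \<noteq> 0" "u \<noteq> 1" "of_nat q * u \<noteq> 1"
      using q0 unfolding u_def by (metis of_nat_0_eq_iff power_not_zero of_nat_power of_nat_mult of_nat_eq_1_iff)+
    have us: "of_nat q powr (- (- of_nat n)) = u"
      unfolding u_def by (rule of_nat_powr_of_nat[OF q0])
    have D: "(1 - u) * (1 - of_nat q * u) \<noteq> 0" using u by simp
    have fq: "f (- of_nat n) = R u / ((1 - u) * (1 - of_nat q * u))"
      using f u us unfolding has_numerator_def Let_def by metis
    have bq: "bump q g (Suc k) (- of_nat n) =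
        u ^ g * pole_factor q u ^ Suc (Suc k) / ((1 - u) * (1 - of_nat q * u))"
      using bump_eq_quotient[OF q0, of "- of_nat n" g "Suc k"] u(2,3) unfolding us by blast
    have bu: "poly b u = (1 - u) * (1 - of_nat q * u)"
      by (simp add: b_def algebra_simps)
    have pf: "pole_factor q u ^ j = poly b u ^ j / u ^ j" for j
      unfolding bu pole_factor_def by (rule power_divide)
    have "f (- of_nat n) / bump q g (Suc k) (- of_nat n) =
        R u / (u ^ g * pole_factor q u ^ Suc (Suc k))"
      unfolding fq bq using D by simp
    also have "\<dots> = poly P u / poly Q u"
      unfolding pf P_def Q_def using pd[OF u(1)] u(1) by (simp del: power_Suc)
    finally show ?case by (simp add: u_def)
  qed
  then have "(\<lambda>n. f (- of_nat n) / bump q g (Suc k) (- of_nat n)) \<longlonglongrightarrow> 0"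
    by (rule Lim_transform_eventually[OF lim])
  then show ?thesis by blast
qed

section \<open>Open and dense\<close>

text \<open>\<open>has_numerator\<close> says nothing at \<open>u = 1\<close> and
  \<open>u = 1/q\<close>, so the vanishing of \<open>h\<close> is first obtained elsewhere and
  carried there by continuity, against the values prescribed by \<open>L_polynomial\<close>.\<close>

lemma R_class_not_identically_0:
  assumes ff: "function_field K F" and fin: "finite K" and f: "f \<in> R_class K F"
  shows "\<exists>s. f s \<noteq> 0"
proof (rule ccontr)
  assume "\<not> ?thesis"
  then have f0: "f s = 0" for s by simp
  let ?q = "of_nat (card K) :: complex"
  have q: "2 \<le> card K" by (rule function_field_card_ge_2[OF ff fin])
  from f obtain h where h: "h holomorphic_on - {0}" "has_numerator (card K) f h" "interpolates_L K F h"
    unfolding R_class_def M_class_def by blast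
  have h0: "h u = 0" if u: "u \<notin> {0, 1, 1 / ?q}" for u
  proof -
    have Ln: "Ln ?q = complex_of_real (ln (real (card K)))"
      using Ln_of_real[of "real (card K)"] q by simp
    have s: "?q powr (- (- Ln u / Ln ?q)) = u"
      using u q by (simp add: powr_def Ln)
    have u1: "u \<noteq> 1" "?q * u \<noteq> 1" using u q by (auto simp: field_simps)
    then have "h u / ((1 - u) * (1 - ?q * u)) = 0"
      using h(2) s f0 unfolding has_numerator_def Let_def by metis
    then show ?thesis using u1 by simp
  qed
  have "h v = 0" if v: "v \<noteq> 0" for v
  proof -
    have "isCont h v"
      using h(1) v by (meson Compl_iff continuous_on_eq_continuous_at holomorphic_on_imp_continuous_on
          open_Compl closed_singleton singletonD)
    then have "h \<midarrow>v\<rightarrow> h v" by (rule isContD)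
    moreover have "\<forall>\<^sub>F u in at v. u \<noteq> w" for w
      by (rule eventually_neq_at_within)
    then have "\<forall>\<^sub>F u in at v. u \<notin> {0, 1, 1 / ?q}"
      by (simp add: eventually_conj_iff)
    then have "\<forall>\<^sub>F u in at v. 0 = h u"
      by eventually_elim (use h0 in auto)
    then have "h \<midarrow>v\<rightarrow> 0"
      by (rule Lim_transform_eventually[OF tendsto_const])
    ultimately show ?thesis by (rule tendsto_unique[OF at_neq_bot])
  qed
  then have "h 1 = 0" "h (1 / ?q) = 0" using q by auto
  then show False
    using L_polynomial_nonzero_at_poles[OF ff fin] h(3) by (simp add: interpolates_L_def Let_def)
qed

lemma R_class_minus_dense:
  assumes ff: "function_field K F" and fin: "finite K" and f: "f \<in> R_class K F"
  shows "\<exists>g. range g \<subseteq> mero_space \<and> mero_converges g f \<and>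
    (\<forall>\<^sub>F n in sequentially. g n \<in> R_class_minus K F)"
proof -
  let ?q = "card K" and ?g = "genus K F"
  have q: "2 \<le> ?q" by (rule function_field_card_ge_2[OF ff fin])
  then have q0: "?q \<noteq> 0" by simp
  from f obtain h R where fm: "f \<in> mero_space" and h: "h holomorphic_on - {0}" "has_numerator ?q f h"
    and sym: "\<And>s. f s = cnj (f (cnj s))"
    and R: "rational_without_poles_on R (- {0})" "has_numerator ?q f R"
    unfolding R_class_def M_class_def by blast
  obtain k where lim: "(\<lambda>n. f (- of_nat n) / bump ?q ?g (Suc k) (- of_nat n)) \<longlonglongrightarrow> 0"
    using quotient_bump_tendsto_0[OF q R] by blast
  define e where "e = bump ?q ?g (Suc k)"
  \<comment> \<open>Chosen so that \<open>g n\<close> vanishes at \<open>s = -n\<close>.\<close>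
  define c where "c n = f (- of_nat n) / e (- of_nat n)" for n :: nat
  define g where "g n = (\<lambda>s. f s - c n * e s)" for n
  have e: "e analytic_on UNIV" unfolding e_def by (rule analytic_bump[OF q0])
  have zero: "e s = 0" if "is_pole f s" for s
    unfolding e_def using bump_eq_0 not_is_pole_has_numerator[OF q0 h] that by blast
  have ce: "(\<lambda>s. a * e s) analytic_on UNIV" for a using e by (intro analytic_intros)
  have fn: "f nicely_meromorphic_on UNIV" using fm by (simp add: mero_space_def)
  note diff = nicely_meromorphic_on_diff_analytic[OF fn ce]
  have gm: "g n \<in> mero_space" for n
    using diff(1)[of "c n"] zero by (simp add: g_def mero_space_def)
  \<comment> \<open>Both \<open>f\<close> and \<open>e\<close> are real at the real point
    \<open>-n\<close>.\<close>
  have "cnj (c n) = c n" for n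
    using sym[of "- of_nat n"] by (simp add: c_def e_def cnj_bump)
  then have gR: "g n \<in> R_class K F" for n
    using R_class_diff_bump[OF q0 f, of "c n" k] gm[of n] by (simp add: g_def e_def)
  have "g n \<in> R_class_minus K F" if n: "1 \<le> n" for n
  proof -
    let ?s = "- of_nat n :: complex"
    have us: "of_nat ?q powr (- ?s) = (of_nat ?q ^ n :: complex)"
      by (rule of_nat_powr_of_nat[OF q0])
    \<comment> \<open>For positive \<open>n\<close> the value \<open>u = q^n\<close> avoids 1 and
      1/q, so at \<open>s = -n\<close> the function \<open>f\<close> has no pole and
      \<open>e\<close> is nonzero.\<close>
    have "?q ^ n \<noteq> 1" "?q * ?q ^ n \<noteq> 1" using q n by auto
    then have u: "of_nat ?q powr (- ?s) \<noteq> (1 :: complex)"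
        "of_nat ?q * of_nat ?q powr (- ?s) \<noteq> (1 :: complex)"
      unfolding us by (metis of_nat_power of_nat_mult of_nat_eq_1_iff)+
    have np: "\<not> is_pole f ?s" by (rule not_is_pole_has_numerator[OF q0 h u])
    have "e ?s \<noteq> 0"
      using u q0 by (simp add: e_def bump_def pole_factor_def Let_def)
    then have "g n ?s = 0" by (simp add: g_def c_def)
    moreover have "\<not> is_pole (g n) ?s"
      using diff(2)[of "c n" ?s] zero np by (simp add: g_def)
    ultimately have "zero_at (g n) ?s" by (simp add: zero_at_def)
    moreover have "Re ?s \<noteq> 1 / 2"
    proof -
      have "Re ?s \<le> 0" by simp
      then show ?thesis by linarith
    qed
    ultimately have "\<not> riemann_hypothesis (g n)" unfolding riemann_hypothesis_def by blast
    then show ?thesis using gR by (simp add: R_class_minus_def)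
  qed
  then have "\<forall>\<^sub>F n in sequentially. g n \<in> R_class_minus K F"
    using eventually_ge_at_top[of 1] by (rule eventually_mono[rotated])
  moreover have "c \<longlonglongrightarrow> 0" using lim by (simp add: c_def[abs_def] e_def)
  then have "mero_converges g f"
    using mero_converges_diff_analytic[OF fm e zero] unfolding g_def by blast
  ultimately show ?thesis using gm by blast
qed

theorem theorem9:
  fixes K :: "'a set" and F :: "('a, 'b) ring_scheme"
  assumes "function_field K F" and "finite K" and "full_constant_field K F"
  shows "openin (subtopology mero_topology (R_class K F)) (R_class_minus K F) \<and>
    (subtopology mero_topology (R_class K F)) closure_of (R_class_minus K F) = R_class K F"
proof
  let ?X = "subtopology mero_topology (R_class K F)"
  let ?U = "{f \<in> mero_space. (\<exists>s. f s \<noteq> 0) \<and> \<not> riemann_hypothesis f}"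
  have sub: "R_class K F \<subseteq> mero_space" by (auto simp: R_class_def M_class_def)
  \<comment> \<open>No function of the class vanishes identically, so the subclass is the trace of
    the open set \<open>?U\<close>.\<close>
  have "R_class_minus K F = ?U \<inter> R_class K F"
    using R_class_not_identically_0[OF assms(1,2)] sub by (auto simp: R_class_minus_def)
  then show "openin ?X (R_class_minus K F)"
    unfolding openin_subtopology openin_mero_topology
    using mero_open_not_riemann_hypothesis by blast
  have top: "topspace ?X = R_class K F"
    using sub by (auto simp: topspace_mero_topology)
  show "?X closure_of R_class_minus K F = R_class K F"
  proof (rule subset_antisym)
    show "?X closure_of R_class_minus K F \<subseteq> R_class K F"
      using closure_of_subset_topspace[of ?X] top by simp
    show "R_class K F \<subseteq> ?X closure_of R_class_minus K F"
    proof
      fix f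
      assume f: "f \<in> R_class K F"
      obtain g where g: "range g \<subseteq> mero_space" "mero_converges g f"
        "\<forall>\<^sub>F n in sequentially. g n \<in> R_class_minus K F"
        using R_class_minus_dense[OF assms(1,2) f] by blast
      \<comment> \<open>Open sets are sequentially open, so a convergent sequence from the subclass
        eventually enters every neighbourhood of \<open>f\<close>.\<close>
      have "\<exists>y. y \<in> R_class_minus K F \<and> y \<in> T" if T: "f \<in> T" "openin ?X T" for T
      proof -
        obtain U where U: "mero_open U" "T = U \<inter> R_class K F"
          using T(2) unfolding openin_subtopology openin_mero_topology by blast
        then have "\<forall>\<^sub>F n in sequentially. g n \<in> U"
          using g(1,2) T(1) unfolding mero_open_def by blast
        then have "\<forall>\<^sub>F n in sequentially. g n \<in> R_class_minus K F \<and> g n \<in> U"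
          using g(3) by eventually_elim simp
        then obtain n where "g n \<in> R_class_minus K F" "g n \<in> U"
          using eventually_happens' sequentially_bot by blast
        then show ?thesis using U(2) by (auto simp: R_class_minus_def)
      qed
      then show "f \<in> ?X closure_of R_class_minus K F"
        unfolding in_closure_of top using f by blast
    qed
  qed
qed

end
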